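(* If a $t$-doped POVM on $n$ data qubits is informationally complete, then $t\ge \frac{2}{\log_2 3}\,n$.
   Context: A $t$-doped POVM on $n$ data qubits is defined as follows: take $m\ge0$ ancilla qubits in a stabilizer state $\ket\psi\in(\mathbb{C}^2)^{\otimes m}$, a unitary $U$ on $n+m$ qubits implemented by a circuit of Clifford gates (generated by Hadamard, phase $S$ and CNOT gates) together with exactly $t$ gates $T=\mathrm{diag}(1,e^{i\pi/4})$, and a stabilizer basis $\{\ket{\Phi'_b}\}_{b=1}^{2^{n+m}}$ (the common eigenbasis of $n+m$ independent commuting Pauli operators). Its elements are $\mu_b=(I\otimes\bra\psi)U^\dagger\ket{\Phi'_b}\!\bra{\Phi'_b}U(I\otimes\ket\psi)$, operators on $(\mathbb{C}^2)^{\otimes n}$. A stabilizer state is the unique state stabilized by an abelian subgroup of order $2^m$ of the $m$-qubit Pauli group not containing $-I$. The POVM is informationally complete if $\dim\operatorname{span}\{\mu_b\}=4^n$. *)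

theory Defs
  imports "HOL-Analysis.Analysis" "Jordan_Normal_Form.Matrix"
begin

text \<open>Conventions. A register of k qubits is modelled by vectors in complex vec of
dimension 2^k; computational basis index a < 2^k, qubit j corresponds to bit j of a.\<close>

definition bitv :: "nat \<Rightarrow> nat \<Rightarrow> nat" where
  "bitv a j = (if bit a j then 1 else 0)"

definition cadj :: "complex mat \<Rightarrow> complex mat" where
  "cadj A = mat (dim_col A) (dim_row A) (\<lambda>(i,j). cnj (A $$ (j,i)))"

text \<open>Pauli operators i^c X^x Z^z on k qubits (x, z bit strings encoded as naturals < 2^k).\<close>
definition pauli_mat :: "nat \<Rightarrow> nat \<Rightarrow> nat \<Rightarrow> nat \<Rightarrow> complex mat" where
  "pauli_mat k c x z = mat (2^k) (2^k) (\<lambda>(a,b).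
      if a = xor b x then \<i>^c * (-1) ^ card {j. j < k \<and> bit z j \<and> bit b j} else 0)"

definition paulis :: "nat \<Rightarrow> complex mat set" where
  "paulis k = {pauli_mat k c x z | c x z. x < 2^k \<and> z < 2^k}"

definition stabilizer_state :: "nat \<Rightarrow> complex vec \<Rightarrow> bool" where
  "stabilizer_state m \<psi> \<longleftrightarrow> \<psi> \<in> carrier_vec (2^m) \<and> (\<Sum>i<2^m. cmod (\<psi> $ i)^2) = 1 \<and>
     (\<exists>S. S \<subseteq> paulis m \<and> 1\<^sub>m (2^m) \<in> S \<and>
          (\<forall>A\<in>S. \<forall>B\<in>S. A * B \<in> S \<and> A * B = B * A) \<and>
          card S = 2^m \<and> - 1\<^sub>m (2^m) \<notin> S \<and>
          (\<forall>P\<in>S. P *\<^sub>v \<psi> = \<psi>))"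

fun mprod :: "nat \<Rightarrow> complex mat list \<Rightarrow> complex mat" where
  "mprod k [] = 1\<^sub>m (2^k)"
| "mprod k (A # As) = A * mprod k As"

definition stabilizer_basis :: "nat \<Rightarrow> (nat \<Rightarrow> complex vec) \<Rightarrow> bool" where
  "stabilizer_basis k \<Phi> \<longleftrightarrow>
     (\<forall>b<2^k. \<Phi> b \<in> carrier_vec (2^k)) \<and>
     (\<forall>b<2^k. \<forall>b'<2^k. (\<Sum>i<2^k. \<Phi> b $ i * cnj (\<Phi> b' $ i)) = (if b = b' then 1 else 0)) \<and>
     (\<exists>gs. length gs = k \<and>
        (\<forall>g\<in>set gs. g \<in> paulis k \<and> cadj g = g) \<and>
        (\<forall>g\<in>set gs. \<forall>h\<in>set gs. g * h = h * g) \<and>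
        (\<forall>A\<subseteq>{..<k}. A \<noteq> {} \<longrightarrow>
            \<not> (\<exists>c. mprod k (map (\<lambda>j. gs ! j) (filter (\<lambda>j. j \<in> A) [0..<k])) = c \<cdot>\<^sub>m 1\<^sub>m (2^k))) \<and>
        (\<forall>b<2^k. \<forall>g\<in>set gs. \<exists>ev. g *\<^sub>v \<Phi> b = ev \<cdot>\<^sub>v \<Phi> b))"

datatype gate = Had nat | Phase nat | CNOT nat nat | Tgate nat

definition had2 :: "complex mat" where
  "had2 = mat 2 2 (\<lambda>(a,b). (if a = 1 \<and> b = 1 then -1 else 1) / complex_of_real (sqrt 2))"
definition phase2 :: "complex mat" where
  "phase2 = mat 2 2 (\<lambda>(a,b). if a = b then (if a = 1 then \<i> else 1) else 0)"
definition t2 :: "complex mat" where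
  "t2 = mat 2 2 (\<lambda>(a,b). if a = b then (if a = 1 then cis (pi / 4) else 1) else 0)"

definition single_gate :: "nat \<Rightarrow> nat \<Rightarrow> complex mat \<Rightarrow> complex mat" where
  "single_gate k j G = mat (2^k) (2^k) (\<lambda>(a,b).
     if (\<forall>i<k. i \<noteq> j \<longrightarrow> bit a i = bit b i) then G $$ (bitv a j, bitv b j) else 0)"

definition cnot_gate :: "nat \<Rightarrow> nat \<Rightarrow> nat \<Rightarrow> complex mat" where
  "cnot_gate k c d = mat (2^k) (2^k) (\<lambda>(a,b).
     if a = (if bit b c then xor b (2^d) else b) then 1 else 0)"

fun gate_mat :: "nat \<Rightarrow> gate \<Rightarrow> complex mat" where
  "gate_mat k (Had j) = single_gate k j had2"
| "gate_mat k (Phase j) = single_gate k j phase2"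
| "gate_mat k (Tgate j) = single_gate k j t2"
| "gate_mat k (CNOT c d) = cnot_gate k c d"

fun gate_wf :: "nat \<Rightarrow> gate \<Rightarrow> bool" where
  "gate_wf k (Had j) = (j < k)"
| "gate_wf k (Phase j) = (j < k)"
| "gate_wf k (Tgate j) = (j < k)"
| "gate_wf k (CNOT c d) = (c < k \<and> d < k \<and> c \<noteq> d)"

fun is_T :: "gate \<Rightarrow> bool" where
  "is_T (Tgate _) = True"
| "is_T _ = False"

definition T_count :: "gate list \<Rightarrow> nat" where
  "T_count gs = length (filter is_T gs)"

text \<open>Unitary of a circuit [g1,...,gL] (g1 applied first): U = G_L ... G_1.\<close>
definition circuit_mat :: "nat \<Rightarrow> gate list \<Rightarrow> complex mat" where
  "circuit_mat k gs = mprod k (rev (map (gate_mat k) gs))"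

text \<open>POVM element mu_b = (I \<otimes> <psi|) U^dagger |Phi_b><Phi_b| U (I \<otimes> |psi>) on n data qubits;
data qubits are qubits 0..n-1, ancillas are qubits n..n+m-1 (basis index a + 2^n * c).\<close>
definition doped_povm_elem :: "nat \<Rightarrow> nat \<Rightarrow> complex vec \<Rightarrow> complex mat \<Rightarrow> complex vec \<Rightarrow> complex mat" where
  "doped_povm_elem n m \<psi> U \<phi> =
     (let w = cadj U *\<^sub>v \<phi>;
          x = (\<lambda>a. \<Sum>c<2^m. cnj (\<psi> $ c) * w $ (a + 2^n * c))
      in mat (2^n) (2^n) (\<lambda>(a,a'). x a * cnj (x a')))"

definition informationally_complete :: "nat \<Rightarrow> (nat \<Rightarrow> complex mat) \<Rightarrow> nat \<Rightarrow> bool" where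
  "informationally_complete n \<mu> N \<longleftrightarrow>
     (\<forall>M \<in> carrier_mat (2^n) (2^n). \<exists>c :: nat \<Rightarrow> complex.
        M = mat (2^n) (2^n) (\<lambda>(i,j). \<Sum>b<N. c b * \<mu> b $$ (i,j)))"

end

(*
In the Heisenberg picture a Clifford gate maps a Pauli operator to a Pauli operator, while a T gate on
qubit j fixes Pauli operators R commuting with Z_j and maps the others to a combination of R and R Z_j.
Recording at each T gate which of the three alternatives (commute, stay, shift) is taken assigns to
every resulting Pauli operator a word w in {0,1,2}^t, and U^* P U lies in the span of the operators R
reached from P. If R, R' are reached from P, P' along the same word, then U^* (P P') U = +-R R'.

The projectors |Phi_b><Phi_b| are combinations of commuting Pauli operators P. Let V = I (x) |psi>. If
V^* R V and V^* R' V are nonzero, then R and R' commute with V V^*, which is the average of a stabilizer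
group. For R, R' with the same word, R R' commutes with all U^* |Phi_b><Phi_b| U, hence
(V^* R V)(V^* R' V) = V^* R R' V commutes with every POVM element and, by informational completeness,
is a scalar. As (V^* R V)^2 = +-1, the operators V^* R V and V^* R' V are proportional. Thus each of
the 3^t words contributes at most one dimension, and 4^n <= 3^t.
*)

theory Submission
  imports Defs "Jordan_Normal_Form.Determinant"
begin

unbundle no vec_syntax

section \<open>Pauli operators\<close>

text \<open>The obstacle is the unbounded ancilla register: the projectors expand in about
  \<open>2^(n+m)\<close> Pauli operators, each with up to \<open>2^t\<close> branches, so counting
  branches gives no bound in \<open>t\<close> alone. Counting words does, provided that all branches
  with one word collapse to a line, whatever their starting operators. Informational completeness
  therefore enters twice: it makes the commutant of the elements trivial, which causes the collapse,
  and it makes their span full in the final count.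

  The alphabet needs three letters although a T gate splits an operator into at most two. If
  commuting and staying shared a letter, one of \<open>R\<close>, \<open>R'\<close> could commute
  with \<open>Z_j\<close> and the other anticommute; then \<open>R R'\<close> anticommutes with
  \<open>Z_j\<close> and the T gate does not fix it. With three letters \<open>R R'\<close> always
  commutes with \<open>Z_j\<close>. The size of the alphabet becomes the constant:
  \<open>4^n <= 3^t\<close> says \<open>2 n <= t log_2 3\<close>.

  Neither the coefficients of the branches nor the sign in front of \<open>R R'\<close> is tracked:
  spans ignore the former, commutation the latter.\<close>

lemma mat_mult_entry:
  assumes "A \<in> carrier_mat p q" "B \<in> carrier_mat q r" "i < p" "j < r"
  shows "(A * B) $$ (i,j) = (\<Sum>l<q. A $$ (i,l) * B $$ (l,j))"
  using assms by (auto simp: scalar_prod_def atLeast0LessThan intro!: sum.cong)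

lemma cadj_carrier [simp]: "A \<in> carrier_mat p q \<Longrightarrow> cadj A \<in> carrier_mat q p"
  by (auto simp: cadj_def)

lemma cadj_entry: "A \<in> carrier_mat p q \<Longrightarrow> i < q \<Longrightarrow> j < p \<Longrightarrow> cadj A $$ (i,j) = cnj (A $$ (j,i))"
  by (auto simp: cadj_def)

lemma cadj_mult:
  assumes "A \<in> carrier_mat p q" "B \<in> carrier_mat q r"
  shows "cadj (A * B) = cadj B * cadj A"
proof (rule eq_matI)
  fix i j assume "i < dim_row (cadj B * cadj A)" "j < dim_col (cadj B * cadj A)"
  then have ij: "i < r" "j < p" using assms by (auto simp: cadj_def)
  have "cadj (A * B) $$ (i,j) = cnj (\<Sum>l<q. A $$ (j,l) * B $$ (l,i))"
    using ij assms by (subst cadj_entry[of _ p r]) (auto simp: mat_mult_entry[OF assms] simp del: index_mult_mat)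
  also have "\<dots> = (\<Sum>l<q. cadj B $$ (i,l) * cadj A $$ (l,j))"
    using ij assms by (auto simp: cadj_entry[of _ p q] cadj_entry[of _ q r] mult.commute intro!: sum.cong)
  also have "\<dots> = (cadj B * cadj A) $$ (i,j)"
    using ij assms by (subst mat_mult_entry[of _ r q _ p]) auto
  finally show "cadj (A * B) $$ (i,j) = (cadj B * cadj A) $$ (i,j)" .
qed (use assms in \<open>auto simp: cadj_def\<close>)

lemma xor_less_exp:
  fixes a b :: nat
  assumes "a < 2^k" "b < 2^k" shows "xor a b < 2^k"
  using assms by (metis take_bit_nat_eq_self_iff take_bit_xor)

lemma exp_bit_eqI:
  fixes a b :: nat
  assumes "a < 2^k" "b < 2^k" "\<And>j. j < k \<Longrightarrow> bit a j = bit b j"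
  shows "a = b"
  using assms by (metis bit_eqI bit_take_bit_iff take_bit_nat_eq_self_iff)

lemma xor_xor_cancel [simp]: "xor (xor a b) (b::nat) = a"
  by (simp add: xor.assoc)

text \<open>The character \<open>(-1)^(z . b)\<close> of bit strings. In product form it is
  multiplicative in each argument factor by factor, which the cardinality in
  \<open>pauli_mat\<close> hides.\<close>

definition chi :: "nat \<Rightarrow> nat \<Rightarrow> nat \<Rightarrow> complex" where
  "chi k z b = (\<Prod>j<k. if bit z j \<and> bit b j then - 1 else 1)"

lemma chi_eq_card: "chi k z b = (-1) ^ card {j. j < k \<and> bit z j \<and> bit b j}"
proof -
  have "{j. j < k \<and> bit z j \<and> bit b j} = {j\<in>{..<k}. bit z j \<and> bit b j}" by auto
  then show ?thesis unfolding chi_def by (simp flip: prod.inter_filter)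
qed

lemma chi_xor_right: "chi k z (xor a b) = chi k z a * chi k z b"
  unfolding chi_def prod.distrib[symmetric] by (rule prod.cong) (auto simp: bit_xor_iff)

lemma chi_xor_left: "chi k (xor a b) z = chi k a z * chi k b z"
  unfolding chi_def prod.distrib[symmetric] by (rule prod.cong) (auto simp: bit_xor_iff)

lemma chi_zero [simp]: "chi k 0 b = 1" "chi k z 0 = 1"
  by (auto simp: chi_def)

lemma chi_square [simp]: "chi k z b * chi k z b = 1"
  unfolding chi_def prod.distrib[symmetric] by (rule prod.neutral) auto

lemma chi_cases: "chi k z b = 1 \<or> chi k z b = -1"
  by (metis chi_square square_eq_1_iff)

lemma cnj_chi [simp]: "cnj (chi k z b) = chi k z b"
  using chi_cases[of k z b] by auto

lemma chi_exp_left: "j < k \<Longrightarrow> chi k (2^j) b = (if bit b j then -1 else 1)"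
proof -
  assume j: "j < k"
  have "chi k (2^j) b = (\<Prod>i\<in>{j}. if bit b i then -1 else 1)"
    unfolding chi_def
    by (rule prod.mono_neutral_cong_right) (use j in \<open>auto simp: bit_exp_iff\<close>)
  then show ?thesis by simp
qed

lemma chi_exp_right: "j < k \<Longrightarrow> chi k b (2^j) = (if bit b j then -1 else 1)"
proof -
  assume j: "j < k"
  have "chi k b (2^j) = (\<Prod>i\<in>{j}. if bit b i then -1 else 1)"
    unfolding chi_def
    by (rule prod.mono_neutral_cong_right) (use j in \<open>auto simp: bit_exp_iff\<close>)
  then show ?thesis by simp
qed

lemma exp_less_exp: "j < k \<Longrightarrow> (2::nat)^j < 2^k"
  by simp

lemma pauli_carrier [simp]: "pauli_mat k c x z \<in> carrier_mat (2^k) (2^k)"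
  by (simp add: pauli_mat_def)

lemma pauli_entry:
  "a < 2^k \<Longrightarrow> b < 2^k \<Longrightarrow> pauli_mat k c x z $$ (a,b) = (if a = xor b x then \<i>^c * chi k z b else 0)"
  by (simp add: pauli_mat_def chi_eq_card)

lemma pauli_dims [simp]: "dim_row (pauli_mat k c x z) = 2^k" "dim_col (pauli_mat k c x z) = 2^k"
  by (simp_all add: pauli_mat_def)

lemma paulisI: "x < 2^k \<Longrightarrow> z < 2^k \<Longrightarrow> pauli_mat k c x z \<in> paulis k"
  unfolding paulis_def by blast

lemma paulisE:
  assumes "P \<in> paulis k"
  obtains c x z where "P = pauli_mat k c x z" "x < 2^k" "z < 2^k"
  using assms unfolding paulis_def by blast

lemma paulis_carrier: "P \<in> paulis k \<Longrightarrow> P \<in> carrier_mat (2^k) (2^k)"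
  by (auto elim: paulisE)

lemma pauli_mult_left:
  assumes "x < 2^k" "A \<in> carrier_mat (2^k) q" "a < 2^k" "b < q"
  shows "(pauli_mat k c x z * A) $$ (a,b) = \<i>^c * chi k z (xor a x) * A $$ (xor a x, b)"
proof -
  have l: "xor a x < 2^k" using assms xor_less_exp by blast
  have "(pauli_mat k c x z * A) $$ (a,b) = (\<Sum>l<2^k. pauli_mat k c x z $$ (a,l) * A $$ (l,b))"
    using assms by (intro mat_mult_entry) auto
  also have "\<dots> = (\<Sum>l\<in>{xor a x}. \<i>^c * chi k z l * A $$ (l, b))"
    by (rule sum.mono_neutral_cong_right) (use l assms in \<open>auto simp: pauli_entry\<close>)
  finally show ?thesis by simp
qed

lemma pauli_mult_right:
  assumes "x < 2^k" "A \<in> carrier_mat p (2^k)" "a < p" "b < 2^k"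
  shows "(A * pauli_mat k c x z) $$ (a,b) = A $$ (a, xor b x) * (\<i>^c * chi k z b)"
proof -
  have l: "xor b x < 2^k" using assms xor_less_exp by blast
  have "(A * pauli_mat k c x z) $$ (a,b) = (\<Sum>l<2^k. A $$ (a,l) * pauli_mat k c x z $$ (l,b))"
    using assms by (intro mat_mult_entry) auto
  also have "\<dots> = (\<Sum>l\<in>{xor b x}. A $$ (a,l) * (\<i>^c * chi k z b))"
    by (rule sum.mono_neutral_cong_right) (use l assms in \<open>auto simp: pauli_entry\<close>)
  finally show ?thesis by simp
qed

lemma pauli_uminus: "- pauli_mat k c x z = pauli_mat k (c+2) x z"
  by (rule eq_matI) (auto simp: pauli_entry power_add)

lemma paulis_uminus: "P \<in> paulis k \<Longrightarrow> - P \<in> paulis k"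
  by (metis paulisE paulisI pauli_uminus)

lemma paulis_one: "1\<^sub>m (2^k) \<in> paulis k"
proof -
  have "1\<^sub>m (2^k) = pauli_mat k 0 0 0"
    by (rule eq_matI) (auto simp: pauli_entry)
  then show ?thesis using paulisI[of 0 k 0 0] by simp
qed

text \<open>The sign comes from moving \<open>Z^z\<close> to the right past \<open>X^x'\<close>; the
  other factors combine by xor. Closure, commutation and squares of \<open>paulis\<close> are read
  off from this formula.\<close>

lemma pauli_mult:
  assumes "x < 2^k" "x' < 2^k"
  shows "pauli_mat k c x z * pauli_mat k c' x' z' =
         chi k z x' \<cdot>\<^sub>m pauli_mat k (c+c') (xor x x') (xor z z')"
proof (rule eq_matI)
  fix a b
  assume "a < dim_row (chi k z x' \<cdot>\<^sub>m pauli_mat k (c+c') (xor x x') (xor z z'))"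
    "b < dim_col (chi k z x' \<cdot>\<^sub>m pauli_mat k (c+c') (xor x x') (xor z z'))"
  then have ab: "a < 2^k" "b < 2^k" by auto
  have *: "xor b x' = a'" if "xor b (xor x x') = xor a' x" for a'
    using that by (metis xor.assoc xor.commute xor_xor_cancel)
  have l: "xor b x' < 2^k" using ab assms xor_less_exp by blast
  show "(pauli_mat k c x z * pauli_mat k c' x' z') $$ (a,b) =
        (chi k z x' \<cdot>\<^sub>m pauli_mat k (c+c') (xor x x') (xor z z')) $$ (a,b)"
    using ab assms l
    by (subst pauli_mult_right[of _ _ _ "2^k"])
       (auto simp: pauli_entry power_add chi_xor_left chi_xor_right ac_simps)
qed auto

lemma pauli_smult_chi: "\<exists>c'. chi k y w \<cdot>\<^sub>m pauli_mat k c x z = pauli_mat k c' x z"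
proof (cases "chi k y w = 1")
  case True
  have "chi k y w \<cdot>\<^sub>m pauli_mat k c x z = pauli_mat k c x z"
    by (rule eq_matI) (auto simp: True)
  then show ?thesis by blast
next
  case False
  then have f: "chi k y w = -1" using chi_cases by blast
  have "chi k y w \<cdot>\<^sub>m pauli_mat k c x z = - pauli_mat k c x z"
    by (rule eq_matI) (auto simp: f)
  then show ?thesis unfolding pauli_uminus by blast
qed

lemma paulis_mult: "P \<in> paulis k \<Longrightarrow> Q \<in> paulis k \<Longrightarrow> P * Q \<in> paulis k"
proof -
  assume "P \<in> paulis k" "Q \<in> paulis k"
  then obtain c x z c' x' z' where e: "P = pauli_mat k c x z" "x < 2^k" "z < 2^k"
    "Q = pauli_mat k c' x' z'" "x' < 2^k" "z' < 2^k" by (metis paulisE)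
  obtain d where "P * Q = pauli_mat k d (xor x x') (xor z z')"
    using pauli_smult_chi pauli_mult e by metis
  then show ?thesis using e by (auto intro!: paulisI xor_less_exp)
qed

text \<open>Both products are the same Pauli operator up to sign, because xor is commutative; only
  the signs \<open>chi k z x'\<close> and \<open>chi k z' x\<close> can differ.\<close>

lemma paulis_commute_or_anticommute:
  assumes "P \<in> paulis k" "Q \<in> paulis k"
  shows "P * Q = Q * P \<or> P * Q = - (Q * P)"
proof -
  obtain c x z c' x' z' where e: "P = pauli_mat k c x z" "x < 2^k" "z < 2^k"
    "Q = pauli_mat k c' x' z'" "x' < 2^k" "z' < 2^k" using assms by (metis paulisE)
  have 1: "P * Q = chi k z x' \<cdot>\<^sub>m pauli_mat k (c+c') (xor x x') (xor z z')"
    "Q * P = chi k z' x \<cdot>\<^sub>m pauli_mat k (c+c') (xor x x') (xor z z')"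
    using e by (simp_all add: pauli_mult ac_simps)
  show ?thesis unfolding 1
    using chi_cases[of k z x'] chi_cases[of k z' x]
    by (auto intro!: eq_matI simp: mat_eq_iff)
qed

lemma paulis_square:
  assumes "P \<in> paulis k"
  shows "P * P = 1\<^sub>m (2^k) \<or> P * P = - 1\<^sub>m (2^k)"
proof -
  obtain c x z where e: "P = pauli_mat k c x z" "x < 2^k" "z < 2^k"
    using assms by (metis paulisE)
  have "\<i>^(c+c) = 1 \<or> \<i>^(c+c) = -1"
    by (metis minus_one_power_iff mult_2 power2_i power_mult)
  then show ?thesis
    unfolding e pauli_mult[OF e(2) e(2)] using chi_cases[of k z x]
    by (auto simp: mat_eq_iff pauli_entry)
qed

lemma paulis_unitary:
  assumes "P \<in> paulis k"
  shows "cadj P * P = 1\<^sub>m (2^k)"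
proof -
  obtain c x z where e: "P = pauli_mat k c x z" "x < 2^k" "z < 2^k"
    using assms by (metis paulisE)
  have n: "cnj (\<i>^c) * \<i>^c = 1"
    by (simp flip: power_mult_distrib)
  show ?thesis
  proof (rule eq_matI)
    fix a b assume "a < dim_row (1\<^sub>m (2^k) :: complex mat)" "b < dim_col (1\<^sub>m (2^k) :: complex mat)"
    then have ab: "a < 2^k" "b < 2^k" by auto
    have x: "xor b x < 2^k" "xor a x < 2^k" using ab e xor_less_exp by auto
    have inj: "xor b x = xor a x \<longleftrightarrow> a = b" by (metis xor_xor_cancel)
    have "(cadj P * P) $$ (a,b) = cadj P $$ (a, xor b x) * (\<i>^c * chi k z b)"
      unfolding e using e ab by (intro pauli_mult_right[of _ _ _ "2^k"]) auto
    also have "\<dots> = cnj (P $$ (xor b x, a)) * (\<i>^c * chi k z b)"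
      using ab x e by (subst cadj_entry[of _ "2^k" "2^k"]) auto
    also have "\<dots> = 1\<^sub>m (2^k) $$ (a,b)"
      using ab x n by (auto simp: e pauli_entry inj) 
       (metis (no_types, lifting) chi_square mult.commute mult.left_commute mult.right_neutral)
    finally show "(cadj P * P) $$ (a,b) = 1\<^sub>m (2^k) $$ (a,b)" .
  qed (use e in \<open>auto simp: cadj_def\<close>)
qed

section \<open>Gates acting on Pauli operators\<close>

text \<open>Row and column index of a nonzero entry of a single-qubit gate can differ in bit
  \<open>j\<close> only, so sums over \<open>2^k\<close> indices reduce to the two terms
  \<open>a\<close> and \<open>xor a (2^j)\<close>.\<close>

lemma agree_off_iff:
  fixes a b :: nat
  assumes "j < k" "a < 2^k" "b < 2^k"
  shows "(\<forall>i<k. i \<noteq> j \<longrightarrow> bit a i = bit b i) \<longleftrightarrow> b = a \<or> b = xor a (2^j)"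
proof
  assume h: "\<forall>i<k. i \<noteq> j \<longrightarrow> bit a i = bit b i"
  show "b = a \<or> b = xor a (2^j)"
  proof (cases "bit a j = bit b j")
    case True
    then have "b = a" using assms h by (intro exp_bit_eqI[of _ k]) auto
    then show ?thesis ..
  next
    case False
    have "b = xor a (2^j)"
      by (rule exp_bit_eqI[of _ k]) (use assms h False in \<open>auto simp: bit_simps intro!: xor_less_exp\<close>)
    then show ?thesis ..
  qed
qed (auto simp: bit_simps)

lemma single_gate_carrier [simp]: "single_gate k j G \<in> carrier_mat (2^k) (2^k)"
  by (simp add: single_gate_def)

lemma single_gate_entry:
  assumes "j < k" "a < 2^k" "b < 2^k"
  shows "single_gate k j G $$ (a,b) =
    (if b = a \<or> b = xor a (2^j) then G $$ (bitv a j, bitv b j) else 0)"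
  using assms by (simp add: single_gate_def agree_off_iff)

lemma bitv_xor_exp: "bitv (xor a (2^j)) j = 1 - bitv a j"
  by (auto simp: bitv_def bit_simps)

lemma bitv_less_2 [simp]: "bitv a j < 2"
  by (simp add: bitv_def)

lemma bitv_cases: "bitv a j = 0 \<or> bitv a j = 1"
  by (simp add: bitv_def)

lemma xor_exp_neq: "xor a (2^j) \<noteq> (a::nat)"
  by (metis bit_exp_iff bit_xor_iff possible_bit_nat)

lemma mat2_mult_entry:
  assumes "A \<in> carrier_mat 2 2" "B \<in> carrier_mat 2 2" "i < 2" "j < 2"
  shows "(A * B) $$ (i,j) = A $$ (i,0) * B $$ (0,j) + A $$ (i,1) * B $$ (1,j)"
  using assms by (subst mat_mult_entry[of _ 2 2 _ 2]) (auto simp: eval_nat_numeral lessThan_Suc add.commute)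

text \<open>Tensoring with the identity is multiplicative. With \<open>single_gate_cadj\<close> and
  \<open>single_gate_one\<close> this reduces unitarity to a 2 by 2 computation.\<close>

lemma single_gate_mult:
  assumes "j < k" "A \<in> carrier_mat 2 2" "B \<in> carrier_mat 2 2"
  shows "single_gate k j A * single_gate k j B = single_gate k j (A * B)"
proof (rule eq_matI)
  fix a b assume "a < dim_row (single_gate k j (A * B))" "b < dim_col (single_gate k j (A * B))"
  then have ab: "a < 2^k" "b < 2^k" by (auto simp: single_gate_def)
  let ?a = "xor a (2^j)"
  have a': "?a < 2^k" using ab assms xor_less_exp exp_less_exp by blast
  have "(single_gate k j A * single_gate k j B) $$ (a,b) =
    (\<Sum>l<2^k. single_gate k j A $$ (a,l) * single_gate k j B $$ (l,b))"
    using ab by (intro mat_mult_entry) auto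
  also have "\<dots> = (\<Sum>l\<in>{a, ?a}. A $$ (bitv a j, bitv l j) * single_gate k j B $$ (l,b))"
    by (rule sum.mono_neutral_cong_right) (use ab a' assms in \<open>auto simp: single_gate_entry\<close>)
  also have "\<dots> = A $$ (bitv a j, bitv a j) * single_gate k j B $$ (a,b) +
       A $$ (bitv a j, 1 - bitv a j) * single_gate k j B $$ (?a,b)"
    using xor_exp_neq[of a j] by (auto simp: bitv_xor_exp)
  also have "\<dots> = (if b = a \<or> b = ?a then A $$ (bitv a j, bitv a j) * B $$ (bitv a j,bitv b j) +
       A $$ (bitv a j, 1 - bitv a j) * B $$ (1 - bitv a j,bitv b j) else 0)"
    using ab a' assms by (auto simp: single_gate_entry bitv_xor_exp)
  also have "\<dots> = (if b = a \<or> b = ?a then (A * B) $$ (bitv a j, bitv b j) else 0)"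
    using bitv_cases[of a j] assms
    by (auto simp: mat2_mult_entry simp del: index_mult_mat)
  also have "\<dots> = single_gate k j (A * B) $$ (a,b)"
    using ab assms by (simp add: single_gate_entry)
  finally show "(single_gate k j A * single_gate k j B) $$ (a,b) = single_gate k j (A * B) $$ (a,b)" .
qed (auto simp: single_gate_def)

lemma single_gate_cadj:
  assumes "j < k" "A \<in> carrier_mat 2 2"
  shows "cadj (single_gate k j A) = single_gate k j (cadj A)"
proof (rule eq_matI)
  fix a b assume "a < dim_row (single_gate k j (cadj A))" "b < dim_col (single_gate k j (cadj A))"
  then have ab: "a < 2^k" "b < 2^k" by (auto simp: single_gate_def)
  show "cadj (single_gate k j A) $$ (a,b) = single_gate k j (cadj A) $$ (a,b)"
    using ab assms by (auto simp: cadj_entry[of _ "2^k" "2^k"] cadj_entry[of _ 2 2] single_gate_entry)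
qed (auto simp: single_gate_def cadj_def)

lemma single_gate_one:
  assumes "j < k" shows "single_gate k j (1\<^sub>m 2) = 1\<^sub>m (2^k)"
proof (rule eq_matI)
  fix a b assume "a < dim_row (1\<^sub>m (2^k) :: complex mat)" "b < dim_col (1\<^sub>m (2^k) :: complex mat)"
  then have ab: "a < 2^k" "b < 2^k" by auto
  have "bitv a j \<noteq> bitv (xor a (2^j)) j"
    using bitv_cases[of a j] by (auto simp: bitv_xor_exp)
  then show "single_gate k j (1\<^sub>m 2) $$ (a,b) = 1\<^sub>m (2^k) $$ (a,b)"
    using ab assms by (auto simp: single_gate_entry)
qed (auto simp: single_gate_def)

lemma single_gate_unitary:
  assumes "j < k" "G \<in> carrier_mat 2 2" "cadj G * G = 1\<^sub>m 2"
  shows "cadj (single_gate k j G) * single_gate k j G = 1\<^sub>m (2^k)"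
  using assms by (simp add: single_gate_cadj single_gate_mult single_gate_one)

lemma eq_mat2I:
  assumes "A \<in> carrier_mat 2 2" "B \<in> carrier_mat 2 2"
    "A $$ (0,0) = B $$ (0,0)" "A $$ (0,1) = B $$ (0,1)" "A $$ (1,0) = B $$ (1,0)" "A $$ (1,1) = B $$ (1,1)"
  shows "A = B"
  by (rule eq_matI) (use assms in \<open>auto simp: less_2_cases_iff\<close>)

lemma mat2_mult_cadj_carrier [simp]: "A \<in> carrier_mat 2 2 \<Longrightarrow> cadj A * A \<in> carrier_mat 2 2"
  by (intro mult_carrier_mat[of _ 2 2]) auto

lemma gates2_carrier [simp]:
  "had2 \<in> carrier_mat 2 2" "phase2 \<in> carrier_mat 2 2" "t2 \<in> carrier_mat 2 2"
  by (simp_all add: had2_def phase2_def t2_def)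

lemma had2_unitary: "cadj had2 * had2 = 1\<^sub>m 2"
proof -
  have "complex_of_real (sqrt 2) * complex_of_real (sqrt 2) = 2"
    by (simp flip: of_real_mult)
  then show ?thesis
    by (intro eq_mat2I) (auto simp: mat2_mult_entry cadj_entry[of _ 2 2] simp del: index_mult_mat, auto simp: had2_def)
qed

lemma phase2_unitary: "cadj phase2 * phase2 = 1\<^sub>m 2"
  by (intro eq_mat2I) (auto simp: mat2_mult_entry cadj_entry[of _ 2 2] simp del: index_mult_mat, auto simp: phase2_def)

lemma t2_unitary: "cadj t2 * t2 = 1\<^sub>m 2"
  by (intro eq_mat2I) (auto simp: mat2_mult_entry cadj_entry[of _ 2 2] simp del: index_mult_mat, auto simp: t2_def cis_cnj cis_mult)

section \<open>The CNOT gate as a linear permutation of bit strings\<close>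

lemma cnot_carrier [simp]: "cnot_gate k c d \<in> carrier_mat (2^k) (2^k)"
  by (simp add: cnot_gate_def)

text \<open>The permutation of basis indices behind \<open>cnot_gate\<close>. It is linear over the
  field with two elements, which is why CNOT sends Pauli operators to Pauli operators.\<close>

definition cnot_perm :: "nat \<Rightarrow> nat \<Rightarrow> nat \<Rightarrow> nat" where
  "cnot_perm c d b = (if bit b c then xor b (2^d) else b)"

lemma cnot_perm_less: "d < k \<Longrightarrow> b < 2^k \<Longrightarrow> cnot_perm c d b < 2^k"
  by (simp add: cnot_perm_def xor_less_exp)

lemma cnot_perm_invol: "c \<noteq> d \<Longrightarrow> cnot_perm c d (cnot_perm c d b) = b"
  by (auto simp: cnot_perm_def bit_simps)

lemma cnot_perm_xor: "cnot_perm c d (xor a b) = xor (cnot_perm c d a) (cnot_perm c d b)"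
  by (auto simp: cnot_perm_def bit_simps intro!: bit_eqI)

lemma cnot_entry:
  "a < 2^k \<Longrightarrow> b < 2^k \<Longrightarrow> cnot_gate k c d $$ (a,b) = (if a = cnot_perm c d b then 1 else 0)"
  by (simp add: cnot_gate_def cnot_perm_def)

lemma cnot_mult_right:
  assumes "d < k" "A \<in> carrier_mat p (2^k)" "a < p" "b < 2^k"
  shows "(A * cnot_gate k c d) $$ (a,b) = A $$ (a, cnot_perm c d b)"
proof -
  have l: "cnot_perm c d b < 2^k" using assms cnot_perm_less by blast
  have "(A * cnot_gate k c d) $$ (a,b) = (\<Sum>l<2^k. A $$ (a,l) * cnot_gate k c d $$ (l,b))"
    using assms by (intro mat_mult_entry) auto
  also have "\<dots> = (\<Sum>l\<in>{cnot_perm c d b}. A $$ (a,l))"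
    by (rule sum.mono_neutral_cong_right) (use l assms in \<open>auto simp: cnot_entry\<close>)
  finally show ?thesis by simp
qed

lemma cnot_unitary:
  assumes "d < k" "c \<noteq> d"
  shows "cadj (cnot_gate k c d) * cnot_gate k c d = 1\<^sub>m (2^k)"
proof (rule eq_matI)
  fix a b assume "a < dim_row (1\<^sub>m (2^k) :: complex mat)" "b < dim_col (1\<^sub>m (2^k) :: complex mat)"
  then have ab: "a < 2^k" "b < 2^k" by auto
  have inj: "cnot_perm c d b = cnot_perm c d a \<longleftrightarrow> a = b"
    using assms cnot_perm_invol by metis
  show "(cadj (cnot_gate k c d) * cnot_gate k c d) $$ (a,b) = 1\<^sub>m (2^k) $$ (a,b)"
    using ab assms
    by (subst cnot_mult_right[of _ _ _ "2^k"])
       (auto simp: cadj_entry[of _ "2^k" "2^k"] cnot_entry cnot_perm_less inj)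
qed (auto simp: cnot_gate_def cadj_def)

lemma gate_carrier [simp]: "gate_mat k g \<in> carrier_mat (2^k) (2^k)"
  by (cases g) auto

lemma gate_unitary:
  assumes "gate_wf k g"
  shows "cadj (gate_mat k g) * gate_mat k g = 1\<^sub>m (2^k)"
  using assms
  by (cases g) (simp_all add: single_gate_unitary had2_unitary phase2_unitary t2_unitary cnot_unitary)

section \<open>Conjugation of Pauli operators by Clifford gates\<close>

lemma diag_gate_entry:
  assumes "j < k" "a < 2^k" "b < 2^k" "G $$ (0,1) = 0" "G $$ (1,0) = 0"
  shows "single_gate k j G $$ (a,b) = (if a = b then G $$ (bitv b j, bitv b j) else 0)"
  using assms bitv_cases[of a j]
  by (auto simp: single_gate_entry bitv_xor_exp eq_commute[of a])

lemma diag_gate_mult_right: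
  assumes "j < k" "A \<in> carrier_mat p (2^k)" "a < p" "b < 2^k" "G $$ (0,1) = 0" "G $$ (1,0) = 0"
  shows "(A * single_gate k j G) $$ (a,b) = A $$ (a,b) * G $$ (bitv b j, bitv b j)"
proof -
  have "(A * single_gate k j G) $$ (a,b) = (\<Sum>l<2^k. A $$ (a,l) * single_gate k j G $$ (l,b))"
    using assms by (intro mat_mult_entry) auto
  also have "\<dots> = (\<Sum>l\<in>{b}. A $$ (a,l) * G $$ (bitv b j, bitv b j))"
    by (rule sum.mono_neutral_cong_right) (use assms in \<open>auto simp: diag_gate_entry\<close>)
  finally show ?thesis by simp
qed

lemma phase_conj:
  assumes "j < k" "P \<in> paulis k"
  shows "\<exists>P'\<in>paulis k. P * single_gate k j phase2 = single_gate k j phase2 * P'"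
proof -
  obtain c x z where P: "P = pauli_mat k c x z" "x < 2^k" "z < 2^k"
    using assms by (metis paulisE)
  \<comment> \<open>From \<open>S^* X S = -i X Z\<close>: a set bit \<open>j\<close> of
    \<open>x\<close> toggles bit \<open>j\<close> of \<open>z\<close>, and the added exponent 3 is
    the phase \<open>-i\<close>.\<close>
  define P' where "P' = (if bit x j then pauli_mat k (c+3) x (xor z (2^j)) else P)"
  have "P' \<in> paulis k"
    using P assms unfolding P'_def by (auto intro!: paulisI xor_less_exp)
  moreover have "P * single_gate k j phase2 = single_gate k j phase2 * P'"
  proof (rule eq_matI)
    fix a b assume "a < dim_row (single_gate k j phase2 * P')" "b < dim_col (single_gate k j phase2 * P')"
    then have ab: "a < 2^k" "b < 2^k" by (auto simp: single_gate_def P'_def P split: if_splits)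
    have l: "xor b x < 2^k" using ab P xor_less_exp by blast
    have ph: "phase2 $$ (bitv e j, bitv e j) = (if bit e j then \<i> else 1)" for e
      by (simp add: phase2_def bitv_def)
    have d: "phase2 $$ (0,1) = 0" "phase2 $$ (1,0) = 0" by (simp_all add: phase2_def)
    have "\<i> ^ 3 = - \<i>" by (simp add: eval_nat_numeral)
    have "(P * single_gate k j phase2) $$ (a,b) = P $$ (a,b) * (if bit b j then \<i> else 1)"
      using ab assms P d by (subst diag_gate_mult_right[of _ _ _ "2^k"]) (auto simp: ph)
    moreover have "(single_gate k j phase2 * P') $$ (a,b) =
       single_gate k j phase2 $$ (a, xor b x) * (if bit x j then \<i>^(c+3) * chi k (xor z (2^j)) b else \<i>^c * chi k z b)"
      unfolding P'_def P using ab assms P by (auto simp: pauli_mult_right[of _ _ _ "2^k"] simp del: index_mult_mat)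
    moreover have ii: "\<i> * (w * \<i> * v) = - (w * v)" for w v
    proof -
      have "\<i> * (w * \<i> * v) = \<i> * \<i> * (w * v)" by (simp only: ac_simps)
      then show ?thesis by simp
    qed
    ultimately show "(P * single_gate k j phase2) $$ (a,b) = (single_gate k j phase2 * P') $$ (a,b)"
      using ab assms P d l \<open>\<i> ^ 3 = - \<i>\<close>
      by (auto simp: diag_gate_entry ph ii pauli_entry chi_xor_left chi_exp_left power_add bit_simps simp del: index_mult_mat)
  qed (auto simp: single_gate_def P'_def P)
  ultimately show ?thesis by blast
qed

text \<open>The transpose of the linear map CNOT under the pairing in \<open>chi\<close> is CNOT
  with control and target exchanged. This gives the action on the \<open>z\<close> label in
  \<open>cnot_conj\<close>.\<close>

lemma chi_cnot_perm:
  assumes "c < k" "d < k" "c \<noteq> d"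
  shows "chi k z (cnot_perm c d b) = chi k (cnot_perm d c z) b"
  using assms by (auto simp: cnot_perm_def chi_xor_left chi_xor_right chi_exp_left chi_exp_right)

lemma cnot_conj:
  assumes "c < k" "d < k" "c \<noteq> d" "P \<in> paulis k"
  shows "\<exists>P'\<in>paulis k. P * cnot_gate k c d = cnot_gate k c d * P'"
proof -
  obtain e x z where P: "P = pauli_mat k e x z" "x < 2^k" "z < 2^k"
    using assms by (metis paulisE)
  define x' where "x' = cnot_perm c d x"
  define P' where "P' = pauli_mat k e x' (cnot_perm d c z)"
  have x': "x' < 2^k" using P assms by (simp add: x'_def cnot_perm_less)
  have "P' \<in> paulis k"
    using P assms x' unfolding P'_def by (auto intro!: paulisI cnot_perm_less)
  moreover have "P * cnot_gate k c d = cnot_gate k c d * P'"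
  proof (rule eq_matI)
    fix a b assume "a < dim_row (cnot_gate k c d * P')" "b < dim_col (cnot_gate k c d * P')"
    then have ab: "a < 2^k" "b < 2^k" by (auto simp: cnot_gate_def P'_def P)
    have l: "xor b x' < 2^k" "cnot_perm c d b < 2^k" using ab x' xor_less_exp assms by (auto simp: cnot_perm_less)
    have p: "cnot_perm c d (xor b x') = xor (cnot_perm c d b) x"
      using assms by (simp add: cnot_perm_xor x'_def cnot_perm_invol)
    have "(P * cnot_gate k c d) $$ (a,b) = P $$ (a, cnot_perm c d b)"
      using ab assms P by (subst cnot_mult_right[of _ _ _ "2^k"]) auto
    moreover have "(cnot_gate k c d * P') $$ (a,b) = 
        cnot_gate k c d $$ (a, xor b x') * (\<i>^e * chi k (cnot_perm d c z) b)"
      unfolding P'_def using ab x' by (subst pauli_mult_right[of _ _ _ "2^k"]) auto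
    ultimately show "(P * cnot_gate k c d) $$ (a,b) = (cnot_gate k c d * P') $$ (a,b)"
      using ab assms P l
      by (auto simp: cnot_entry p pauli_entry chi_cnot_perm simp del: index_mult_mat)
  qed (auto simp: cnot_gate_def P'_def P)
  ultimately show ?thesis by blast
qed

text \<open>Bit \<open>j\<close> of \<open>x\<close> is replaced by bit \<open>j\<close> of
  \<open>z\<close>; applied in both orders, this exchanges the X and Z parts at qubit
  \<open>j\<close>. Writing it with xor makes \<open>chi_xor_left\<close> applicable.\<close>

definition had_swap :: "nat \<Rightarrow> nat \<Rightarrow> nat \<Rightarrow> nat" where
  "had_swap j x z = (if bit x j = bit z j then x else xor x (2^j))"

lemma bit_had_swap: "bit (had_swap j x z) i = (if i = j then bit z i else bit x i)"
  by (auto simp: had_swap_def bit_simps)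

lemma had_conj:
  assumes "j < k" "P \<in> paulis k"
  shows "\<exists>P'\<in>paulis k. P * single_gate k j had2 = single_gate k j had2 * P'"
proof -
  obtain c x z where P: "P = pauli_mat k c x z" "x < 2^k" "z < 2^k"
    using assms by (metis paulisE)
  define x' where "x' = had_swap j x z"
  define z' where "z' = had_swap j z x"
  \<comment> \<open>The exponent \<open>c + 2\<close> is the sign in
    \<open>H X Z H = Z X = - X Z\<close>, present only if qubit \<open>j\<close> carries both
    factors.\<close>
  define P' where "P' = pauli_mat k (if bit x j \<and> bit z j then c + 2 else c) x' z'"
  have x': "x' < 2^k" "z' < 2^k"
    using P assms by (auto simp: x'_def z'_def had_swap_def intro!: xor_less_exp)
  then have "P' \<in> paulis k"
    unfolding P'_def by (auto intro!: paulisI)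
  moreover have "P * single_gate k j had2 = single_gate k j had2 * P'"
  proof (rule eq_matI)
    fix a b assume "a < dim_row (single_gate k j had2 * P')" "b < dim_col (single_gate k j had2 * P')"
    then have ab: "a < 2^k" "b < 2^k" by (auto simp: single_gate_def P'_def P)
    have l: "xor b x' < 2^k" "xor a x < 2^k" using ab x' P xor_less_exp by auto
    define h where "h p q = had2 $$ (if p then 1 else 0, if q then 1 else 0)" for p q
    have h: "h p q = (if p \<and> q then -1 else 1) / complex_of_real (sqrt 2)" for p q
      by (simp add: h_def had2_def)
    \<comment> \<open>\<open>off\<close> says that \<open>xor a x\<close> and \<open>b\<close> agree
      outside qubit \<open>j\<close>; otherwise both sides have entry 0.\<close>
    define off where "off = (\<forall>i<k. i \<noteq> j \<longrightarrow> bit a i = (bit b i \<noteq> bit x i))"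
    have sg: "single_gate k j had2 $$ (p,q) =
        (if (\<forall>i<k. i \<noteq> j \<longrightarrow> bit p i = bit q i) then h (bit p j) (bit q j) else 0)"
      if "p < 2^k" "q < 2^k" for p q using that by (auto simp: single_gate_def bitv_def h_def)
    have "(P * single_gate k j had2) $$ (a,b) = \<i>^c * chi k z (xor a x) * single_gate k j had2 $$ (xor a x, b)"
      unfolding P using ab P by (intro pauli_mult_left) auto
    also have "single_gate k j had2 $$ (xor a x, b) = (if off then h (bit a j \<noteq> bit x j) (bit b j) else 0)"
      using ab l by (subst sg) (auto simp: off_def bit_simps)
    finally have 1: "(P * single_gate k j had2) $$ (a,b) =
       \<i>^c * chi k z (xor a x) * (if off then h (bit a j \<noteq> bit x j) (bit b j) else 0)" .
    have "(single_gate k j had2 * P') $$ (a,b) = single_gate k j had2 $$ (a, xor b x') *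
       (\<i>^(if bit x j \<and> bit z j then c + 2 else c) * chi k z' b)"
      unfolding P'_def using ab x' by (intro pauli_mult_right) auto
    also have "single_gate k j had2 $$ (a, xor b x') = (if off then h (bit a j) (bit b j \<noteq> bit z j) else 0)"
      using ab l by (subst sg) (auto simp: off_def bit_simps bit_had_swap x'_def)
    finally have 2: "(single_gate k j had2 * P') $$ (a,b) = (if off then h (bit a j) (bit b j \<noteq> bit z j) else 0) *
       (\<i>^(if bit x j \<and> bit z j then c + 2 else c) * chi k z' b)" .
    show "(P * single_gate k j had2) $$ (a,b) = (single_gate k j had2 * P') $$ (a,b)"
    proof (cases off)
      case True
      \<comment> \<open>\<open>z0\<close> is \<open>z\<close> with bit \<open>j\<close> cleared.
        This separates the contribution of qubit \<open>j\<close> to \<open>chi\<close> from that of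
        the other qubits, where \<open>xor a x\<close> and \<open>b\<close> agree.\<close>
      define z0 where "z0 = (if bit z j then xor z (2^j) else z)"
      have z0: "\<not> bit z0 j" by (auto simp: z0_def bit_simps)
      have zz: "chi k z e = chi k z0 e * (if bit z j \<and> bit e j then -1 else 1)" for e
        using assms by (auto simp: z0_def chi_xor_left chi_exp_left)
      have zz': "chi k z' e = chi k z0 e * (if bit x j \<and> bit e j then -1 else 1)" for e
        using assms by (auto simp: z'_def had_swap_def z0_def chi_xor_left chi_exp_left)
      have "chi k z0 (xor a x) = chi k z0 b"
        unfolding chi_def by (rule prod.cong) (use True z0 in \<open>auto simp: off_def bit_simps\<close>)
      then show ?thesis
        unfolding 1 2 h zz zz' using True
        by (auto simp: power_add bit_simps)
    qed (auto simp: 1 2)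
  qed (auto simp: single_gate_def P'_def P)
  ultimately show ?thesis by blast
qed

lemma clifford_conj:
  assumes "gate_wf k g" "\<not> is_T g" "P \<in> paulis k"
  shows "\<exists>P'\<in>paulis k. P * gate_mat k g = gate_mat k g * P'"
  using assms by (cases g) (auto simp: had_conj phase_conj cnot_conj)

lemma clifford_conj_paulis:
  assumes "gate_wf k g" "\<not> is_T g" "P \<in> paulis k"
  shows "cadj (gate_mat k g) * P * gate_mat k g \<in> paulis k"
proof -
  let ?G = "gate_mat k g"
  obtain P' where P': "P' \<in> paulis k" "P * ?G = ?G * P'" using clifford_conj assms by blast
  have c: "P \<in> carrier_mat (2^k) (2^k)" "P' \<in> carrier_mat (2^k) (2^k)" "?G \<in> carrier_mat (2^k) (2^k)"
    using assms P' paulis_carrier by auto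
  have "cadj ?G * P * ?G = cadj ?G * (P * ?G)"
    using c by (intro assoc_mult_mat[of _ "2^k" "2^k" _ "2^k" _ "2^k"]) auto
  also have "\<dots> = (cadj ?G * ?G) * P'"
    unfolding P' using c by (intro assoc_mult_mat[of _ "2^k" "2^k" _ "2^k" _ "2^k", symmetric]) auto
  also have "\<dots> = P'" using gate_unitary[OF assms(1)] c by simp
  finally show ?thesis using P' by simp
qed

section \<open>The T gate as a combination of the identity and \<open>Z\<close>\<close>

definition Zq :: "nat \<Rightarrow> nat \<Rightarrow> complex mat" where
  "Zq k j = pauli_mat k 0 0 (2^j)"

lemma Zq_paulis: "j < k \<Longrightarrow> Zq k j \<in> paulis k"
  unfolding Zq_def by (auto intro!: paulisI)

text \<open>The coefficients solve \<open>a + b = 1\<close> and \<open>a - b = cis (pi/4)\<close>.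
  With \<open>T\<close> in the span of the identity and \<open>Z\<close>, its action on an operator
  depends only on how that operator commutes with \<open>Z\<close>.\<close>

lemma T_gate_expand:
  assumes "j < k"
  shows "single_gate k j t2 = ((1 + cis (pi/4)) / 2) \<cdot>\<^sub>m 1\<^sub>m (2^k) + ((1 - cis (pi/4)) / 2) \<cdot>\<^sub>m Zq k j"
proof (rule eq_matI)
  fix a b assume "a < dim_row (((1 + cis (pi/4)) / 2) \<cdot>\<^sub>m 1\<^sub>m (2^k) + ((1 - cis (pi/4)) / 2) \<cdot>\<^sub>m Zq k j)"
    "b < dim_col (((1 + cis (pi/4)) / 2) \<cdot>\<^sub>m 1\<^sub>m (2^k) + ((1 - cis (pi/4)) / 2) \<cdot>\<^sub>m Zq k j)"
  then have ab: "a < 2^k" "b < 2^k" by (auto simp: Zq_def)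
  have t: "t2 $$ (0,1) = 0" "t2 $$ (1,0) = 0" by (auto simp: t2_def)
  show "single_gate k j t2 $$ (a,b) = (((1 + cis (pi/4)) / 2) \<cdot>\<^sub>m 1\<^sub>m (2^k) + ((1 - cis (pi/4)) / 2) \<cdot>\<^sub>m Zq k j) $$ (a,b)"
    using ab assms t by (auto simp: diag_gate_entry Zq_def pauli_entry chi_exp_left bitv_def field_simps) (auto simp: t2_def)
qed (auto simp: single_gate_def Zq_def)

section \<open>Heisenberg branches of a Pauli operator through a circuit\<close>

definition conj_by :: "complex mat \<Rightarrow> complex mat \<Rightarrow> complex mat" where
  "conj_by G A = cadj G * A * G"

text \<open>Lying in a span is expressed as lying in every such \<open>W\<close> that contains the
  generators. In this form an induction over a circuit can replace \<open>W\<close> by its preimage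
  under a conjugation.\<close>

definition msubspace :: "nat \<Rightarrow> complex mat set \<Rightarrow> bool" where
  "msubspace n W \<longleftrightarrow> W \<subseteq> carrier_mat n n \<and> 0\<^sub>m n n \<in> W \<and>
     (\<forall>A\<in>W. \<forall>B\<in>W. A + B \<in> W) \<and> (\<forall>A\<in>W. \<forall>c. c \<cdot>\<^sub>m A \<in> W)"

lemma msubspace_add: "msubspace n W \<Longrightarrow> A \<in> W \<Longrightarrow> B \<in> W \<Longrightarrow> A + B \<in> W"
  and msubspace_smult: "msubspace n W \<Longrightarrow> A \<in> W \<Longrightarrow> c \<cdot>\<^sub>m A \<in> W"
  and msubspace_zero: "msubspace n W \<Longrightarrow> 0\<^sub>m n n \<in> W"
  and msubspace_carrier: "msubspace n W \<Longrightarrow> A \<in> W \<Longrightarrow> A \<in> carrier_mat n n"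
  unfolding msubspace_def by blast+

lemma msubspace_sum:
  assumes W: "msubspace n W" and "finite I" "\<And>i. i \<in> I \<Longrightarrow> A i \<in> W"
  shows "mat n n (\<lambda>p. \<Sum>i\<in>I. f i * A i $$ p) \<in> W"
  using assms(2,3)
proof (induction I rule: finite_induct)
  case empty
  have "mat n n (\<lambda>p. \<Sum>i\<in>{}. f i * A i $$ p) = 0\<^sub>m n n" by (rule eq_matI) auto
  then show ?case using msubspace_zero[OF W] by simp
next
  case (insert j I)
  have c: "A j \<in> carrier_mat n n" using insert msubspace_carrier[OF W] by auto
  have "mat n n (\<lambda>p. \<Sum>i\<in>insert j I. f i * A i $$ p) =
      f j \<cdot>\<^sub>m A j + mat n n (\<lambda>p. \<Sum>i\<in>I. f i * A i $$ p)"
    using insert c by (intro eq_matI) auto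
  then show ?case using insert by (auto intro!: msubspace_add[OF W] msubspace_smult[OF W])
qed

lemma assoc_mult_square_mat:
  fixes A B C :: "'a :: semiring_0 mat"
  assumes "A \<in> carrier_mat n n" "B \<in> carrier_mat n n" "C \<in> carrier_mat n n"
  shows "A * B * C = A * (B * C)"
  using assms by (rule assoc_mult_mat)

lemma conj_by_carrier:
  "G \<in> carrier_mat p q \<Longrightarrow> A \<in> carrier_mat p p \<Longrightarrow> conj_by G A \<in> carrier_mat q q"
  unfolding conj_by_def by (rule mult_carrier_mat[OF mult_carrier_mat[OF cadj_carrier]])

text \<open>The factor \<open>G * cadj G\<close> arises between \<open>A\<close> and
  \<open>B\<close>, so unitarity is needed in the order opposite to that of
  \<open>gate_unitary\<close> and \<open>circuit_unitary\<close>; their primed versions supply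
  it.\<close>

lemma conj_by_mult:
  assumes "G \<in> carrier_mat n n" "A \<in> carrier_mat n n" "B \<in> carrier_mat n n" "G * cadj G = 1\<^sub>m n"
  shows "conj_by G (A * B) = conj_by G A * conj_by G B"
proof -
  note c = assms(1-3) cadj_carrier[OF assms(1)]
  note m = mult_carrier_mat[of _ n n _ n]
  have "conj_by G A * conj_by G B = cadj G * A * ((G * cadj G) * (B * G))"
    unfolding conj_by_def using c by (simp add: assoc_mult_square_mat[of _ n] m)
  also have "\<dots> = conj_by G (A * B)"
    unfolding assms(4) conj_by_def using c by (simp add: assoc_mult_square_mat[of _ n] m left_mult_one_mat[of _ n n])
  finally show ?thesis by simp
qed

lemma conj_by_compose:
  assumes "U \<in> carrier_mat n n" "G \<in> carrier_mat n n" "A \<in> carrier_mat n n"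
  shows "conj_by (U * G) A = conj_by G (conj_by U A)"
proof -
  note c = assms cadj_carrier[OF assms(1)] cadj_carrier[OF assms(2)]
  note m = mult_carrier_mat[of _ n n _ n]
  show ?thesis unfolding conj_by_def using c by (simp add: cadj_mult[of _ n n _ n] assoc_mult_square_mat[of _ n] m)
qed

lemma conj_by_add:
  assumes "G \<in> carrier_mat p q" "A \<in> carrier_mat p p" "B \<in> carrier_mat p p"
  shows "conj_by G (A + B) = conj_by G A + conj_by G B"
proof -
  have c: "cadj G * A \<in> carrier_mat q p" "cadj G * B \<in> carrier_mat q p"
    using assms by (auto intro!: mult_carrier_mat[of _ q p])
  show ?thesis
    unfolding conj_by_def using assms c
    by (simp add: mult_add_distrib_mat[of _ q p _ p] add_mult_distrib_mat[of _ q p _ _ q])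
qed

lemma conj_by_smult:
  assumes "G \<in> carrier_mat p q" "A \<in> carrier_mat p p"
  shows "conj_by G (c \<cdot>\<^sub>m A) = c \<cdot>\<^sub>m conj_by G A"
proof -
  have c: "cadj G * A \<in> carrier_mat q p"
    using assms by (auto intro!: mult_carrier_mat[of _ q p])
  show ?thesis
    unfolding conj_by_def using assms c
    by (simp add: mult_smult_distrib[of _ q p _ p] mult_smult_assoc_mat[of _ q p _ q])
qed

lemma conj_by_uminus:
  assumes "G \<in> carrier_mat p q" "A \<in> carrier_mat p p"
  shows "conj_by G (- A) = - conj_by G A"
proof -
  have "- B = (-1) \<cdot>\<^sub>m B" for B :: "complex mat" by (rule eq_matI) auto
  then show ?thesis using conj_by_smult[OF assms, of "-1"] by simp
qed

lemma conj_by_msubspace: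
  assumes "G \<in> carrier_mat p q" "msubspace q W"
  shows "msubspace p {A \<in> carrier_mat p p. conj_by G A \<in> W}"
proof -
  have "conj_by G (0\<^sub>m p p) = 0\<^sub>m q q"
    unfolding conj_by_def using assms by (simp add: right_mult_zero_mat[of _ q p] left_mult_zero_mat[of _ p q])
  then show ?thesis
    using assms unfolding msubspace_def by (auto simp: conj_by_add conj_by_smult)
qed

section \<open>Circuits and their unitarity\<close>

lemma circuit_mat_Nil: "circuit_mat k [] = 1\<^sub>m (2^k)"
  by (simp add: circuit_mat_def)

lemma mprod_carrier:
  "(\<And>A. A \<in> set As \<Longrightarrow> A \<in> carrier_mat (2^k) (2^k)) \<Longrightarrow> mprod k As \<in> carrier_mat (2^k) (2^k)"
  by (induction As) (auto intro!: mult_carrier_mat[of _ _ "2^k"])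

lemma mprod_snoc:
  assumes "\<And>A. A \<in> set As \<Longrightarrow> A \<in> carrier_mat (2^k) (2^k)" "G \<in> carrier_mat (2^k) (2^k)"
  shows "mprod k (As @ [G]) = mprod k As * G"
  using assms
proof (induction As)
  case (Cons A As)
  then show ?case by (simp add: assoc_mult_square_mat[of _ "2^k"] mprod_carrier)
qed simp

lemma circuit_mat_Cons: "circuit_mat k (g # C) = circuit_mat k C * gate_mat k g"
  unfolding circuit_mat_def by (simp, subst mprod_snoc) auto

lemma circuit_carrier [simp]: "circuit_mat k C \<in> carrier_mat (2^k) (2^k)"
  unfolding circuit_mat_def by (rule mprod_carrier) auto

lemma circuit_unitary:
  assumes "\<forall>g\<in>set C. gate_wf k g"
  shows "cadj (circuit_mat k C) * circuit_mat k C = 1\<^sub>m (2^k)"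
  using assms
proof (induction C)
  case Nil
  have "cadj (1\<^sub>m (2^k)) = (1\<^sub>m (2^k) :: complex mat)"
    by (rule eq_matI) (auto simp: cadj_def)
  then show ?case by (simp add: circuit_mat_Nil)
next
  case (Cons g C)
  let ?U = "circuit_mat k C" and ?G = "gate_mat k g"
  have c: "cadj ?U \<in> carrier_mat (2^k) (2^k)" "cadj ?G \<in> carrier_mat (2^k) (2^k)" by simp_all
  have "cadj (?U * ?G) * (?U * ?G) = cadj ?G * ((cadj ?U * ?U) * ?G)"
    using c by (simp add: cadj_mult[of _ "2^k" "2^k" _ "2^k"] assoc_mult_square_mat[of _ "2^k"] mult_carrier_mat[of _ "2^k" "2^k" _ "2^k"])
  also have "\<dots> = cadj ?G * ?G" using Cons by (simp add: left_mult_one_mat[of _ "2^k" "2^k"])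
  also have "\<dots> = 1\<^sub>m (2^k)" using Cons.prems gate_unitary by simp
  finally show ?case by (simp add: circuit_mat_Cons)
qed

lemma circuit_unitary':
  assumes "\<forall>g\<in>set C. gate_wf k g"
  shows "circuit_mat k C * cadj (circuit_mat k C) = 1\<^sub>m (2^k)"
  using mat_mult_left_right_inverse[of "cadj (circuit_mat k C)" "2^k" "circuit_mat k C"] circuit_unitary[OF assms]
  by simp

lemma gate_unitary': "gate_wf k g \<Longrightarrow> gate_mat k g * cadj (gate_mat k g) = 1\<^sub>m (2^k)"
  using mat_mult_left_right_inverse[of "cadj (gate_mat k g)" "2^k" "gate_mat k g"] gate_unitary
  by simp

section \<open>Conjugation by a T gate\<close>

lemma Zq_square: "j < k \<Longrightarrow> Zq k j * Zq k j = 1\<^sub>m (2^k)"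
  unfolding Zq_def by (subst pauli_mult) (auto intro!: eq_matI simp: pauli_entry)

lemma cadj_T_gate:
  assumes "j < k"
  shows "cadj (single_gate k j t2) =
    (cnj ((1 + cis (pi/4)) / 2)) \<cdot>\<^sub>m 1\<^sub>m (2^k) + (cnj ((1 - cis (pi/4)) / 2)) \<cdot>\<^sub>m Zq k j"
  unfolding T_gate_expand[OF assms]
  by (rule eq_matI) (auto simp: cadj_def Zq_def pauli_entry)

lemma conj_T_commute:
  assumes "j < k" "R \<in> carrier_mat (2^k) (2^k)" "R * Zq k j = Zq k j * R"
  shows "conj_by (gate_mat k (Tgate j)) R = R"
proof -
  let ?T = "single_gate k j t2"
  have z: "Zq k j \<in> carrier_mat (2^k) (2^k)" by (simp add: Zq_def)
  have "R * ?T = ?T * R"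
    unfolding T_gate_expand[OF assms(1)] using assms z
    by (simp add: mult_add_distrib_mat[of _ "2^k" "2^k" _ "2^k"] add_mult_distrib_mat[of _ "2^k" "2^k" _ _ "2^k"]
      mult_smult_distrib[of _ "2^k" "2^k" _ "2^k"] mult_smult_assoc_mat[of _ "2^k" "2^k" _ "2^k"])
  moreover have "conj_by ?T R = cadj ?T * (R * ?T)"
    unfolding conj_by_def using assms by (simp add: assoc_mult_square_mat[of _ "2^k"])
  moreover have "cadj ?T * (?T * R) = (cadj ?T * ?T) * R"
    using assms by (simp add: assoc_mult_square_mat[of _ "2^k"])
  ultimately show ?thesis
    using single_gate_unitary[OF assms(1) _ t2_unitary] assms by simp
qed

text \<open>Expanding \<open>T = a + b Z\<close> on both sides gives \<open>R\<close>,
  \<open>R Z\<close>, \<open>Z R = - R Z\<close> and \<open>Z R Z = - R\<close>, so two operators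
  remain. Only their span matters, hence the coefficients stay existential.\<close>

lemma conj_T_anticommute:
  assumes "j < k" "R \<in> carrier_mat (2^k) (2^k)" "R * Zq k j = - (Zq k j * R)"
  shows "\<exists>\<alpha> \<beta>. conj_by (gate_mat k (Tgate j)) R = \<alpha> \<cdot>\<^sub>m R + \<beta> \<cdot>\<^sub>m (R * Zq k j)"
proof -
  let ?T = "single_gate k j t2" and ?N = "2^k :: nat"
  define a where "a = (1 + cis (pi/4)) / 2"
  define b where "b = (1 - cis (pi/4)) / 2"
  define Z where "Z = Zq k j"
  have z: "Z \<in> carrier_mat ?N ?N" by (simp add: Z_def Zq_def)
  note R = assms(2)
  have RZ: "R * Z \<in> carrier_mat ?N ?N" "Z * R \<in> carrier_mat ?N ?N"
    using R z by (auto intro: mult_carrier_mat[of _ _ ?N])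
  have ZR: "Z * R = - (R * Z)"
    using assms(3) unfolding Z_def[symmetric] by simp
  have ZRZ: "Z * (R * Z) = - R"
  proof -
    have "Z * (R * Z) = - (Z * (Z * R))"
      using assms(3) R z RZ unfolding Z_def[symmetric] by (simp add: ZR)
    also have "Z * (Z * R) = (Z * Z) * R"
      using R z by (simp add: assoc_mult_square_mat[of _ ?N])
    also have "\<dots> = R" using Zq_square[OF assms(1)] R unfolding Z_def[symmetric] by simp
    finally show ?thesis .
  qed
  have T: "?T = a \<cdot>\<^sub>m 1\<^sub>m ?N + b \<cdot>\<^sub>m Z" "cadj ?T = cnj a \<cdot>\<^sub>m 1\<^sub>m ?N + cnj b \<cdot>\<^sub>m Z"
    using T_gate_expand[OF assms(1)] cadj_T_gate[OF assms(1)] by (simp_all add: a_def b_def Z_def)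
  have 1: "R * ?T = a \<cdot>\<^sub>m R + b \<cdot>\<^sub>m (R * Z)"
    unfolding T using R z
    by (simp add: mult_add_distrib_mat[of _ ?N ?N _ ?N] mult_smult_distrib[of _ ?N ?N _ ?N])
  have 2: "cadj ?T * X = cnj a \<cdot>\<^sub>m X + cnj b \<cdot>\<^sub>m (Z * X)" if "X \<in> carrier_mat ?N ?N" for X
    unfolding T(2) using that z
    by (simp add: add_mult_distrib_mat[of _ ?N ?N _ _ ?N] mult_smult_assoc_mat[of _ ?N ?N _ ?N])
  have "conj_by ?T R = cadj ?T * (a \<cdot>\<^sub>m R + b \<cdot>\<^sub>m (R * Z))"
    unfolding conj_by_def 1[symmetric] using R by (simp add: assoc_mult_square_mat[of _ ?N])
  also have "\<dots> = a \<cdot>\<^sub>m (cnj a \<cdot>\<^sub>m R + cnj b \<cdot>\<^sub>m (- (R * Z))) + b \<cdot>\<^sub>m (cnj a \<cdot>\<^sub>m (R * Z) + cnj b \<cdot>\<^sub>m (- R))"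
    using R z RZ
    by (simp add: 2 mult_add_distrib_mat[of _ ?N ?N _ ?N] mult_smult_distrib[of _ ?N ?N _ ?N] ZRZ ZR)
  also have "\<dots> = (cnj a * a - cnj b * b) \<cdot>\<^sub>m R + (cnj a * b - cnj b * a) \<cdot>\<^sub>m (R * Z)"
  proof -
    have "a \<cdot>\<^sub>m (cnj a \<cdot>\<^sub>m R + cnj b \<cdot>\<^sub>m (- W)) + b \<cdot>\<^sub>m (cnj a \<cdot>\<^sub>m W + cnj b \<cdot>\<^sub>m (- R)) =
       (cnj a * a - cnj b * b) \<cdot>\<^sub>m R + (cnj a * b - cnj b * a) \<cdot>\<^sub>m W" if "W \<in> carrier_mat ?N ?N" for W
      using that R by (intro eq_matI) (auto simp: algebra_simps)
    then show ?thesis using RZ by blast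
  qed
  finally show ?thesis unfolding Z_def by auto
qed

text \<open>The head of the gate list acts first on states, hence last on operators. Scalar
coefficients are not recorded.\<close>

inductive pauli_branch :: "nat \<Rightarrow> complex mat \<Rightarrow> gate list \<Rightarrow> nat list \<Rightarrow> complex mat \<Rightarrow> bool"
  for k P where
  Nil: "pauli_branch k P [] [] P"
| Clifford: "pauli_branch k P C w R \<Longrightarrow> \<not> is_T g \<Longrightarrow> pauli_branch k P (g # C) w (conj_by (gate_mat k g) R)"
| commute: "pauli_branch k P C w R \<Longrightarrow> R * Zq k j = Zq k j * R \<Longrightarrow> pauli_branch k P (Tgate j # C) (0 # w) R"
| stay: "pauli_branch k P C w R \<Longrightarrow> R * Zq k j = - (Zq k j * R) \<Longrightarrow> pauli_branch k P (Tgate j # C) (1 # w) R"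
| shift: "pauli_branch k P C w R \<Longrightarrow> R * Zq k j = - (Zq k j * R) \<Longrightarrow> pauli_branch k P (Tgate j # C) (2 # w) (R * Zq k j)"

lemma pauli_branch_word: "pauli_branch k P C w R \<Longrightarrow> set w \<subseteq> {..<3} \<and> length w = T_count C"
  by (induction rule: pauli_branch.induct) (auto simp: T_count_def)

lemma pauli_branch_paulis:
  "pauli_branch k P C w R \<Longrightarrow> P \<in> paulis k \<Longrightarrow> \<forall>g\<in>set C. gate_wf k g \<Longrightarrow> R \<in> paulis k"
proof (induction rule: pauli_branch.induct)
  case (shift C w R j)
  then have "R \<in> paulis k" "Zq k j \<in> paulis k" by (auto intro: Zq_paulis)
  then show ?case by (rule paulis_mult)
qed (auto simp: conj_by_def intro: clifford_conj_paulis)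

text \<open>The head gate \<open>g\<close> conjugates last, so the induction hypothesis is applied
  to the preimage of \<open>W\<close> under conjugation by \<open>g\<close>. A branch of the tail
  lies in that preimage because its one or two continuations through \<open>g\<close> lie in
  \<open>W\<close>.\<close>

lemma conj_circuit_in_msubspace:
  assumes "P \<in> paulis k" "\<forall>g\<in>set C. gate_wf k g" "msubspace (2^k) W"
    "\<And>w R. pauli_branch k P C w R \<Longrightarrow> R \<in> W"
  shows "conj_by (circuit_mat k C) P \<in> W"
  using assms(2-)
proof (induction C arbitrary: W)
  case Nil
  have "cadj (1\<^sub>m (2^k)) = (1\<^sub>m (2^k) :: complex mat)"
    by (rule eq_matI) (auto simp: cadj_def)
  then show ?case using Nil(3)[OF pauli_branch.Nil] paulis_carrier[OF assms(1)]
    by (simp add: circuit_mat_Nil conj_by_def)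
next
  case (Cons g C)
  let ?G = "gate_mat k g"
  have "conj_by (circuit_mat k C) P \<in> {A \<in> carrier_mat (2^k) (2^k). conj_by ?G A \<in> W}"
  proof (rule Cons.IH)
    show "\<forall>g\<in>set C. gate_wf k g" using Cons by simp
    show "msubspace (2^k) {A \<in> carrier_mat (2^k) (2^k). conj_by ?G A \<in> W}"
      using Cons by (intro conj_by_msubspace[of _ _ "2^k"]) auto
    fix w R assume p: "pauli_branch k P C w R"
    have R: "R \<in> paulis k" using pauli_branch_paulis p assms(1) Cons by auto
    have "conj_by ?G R \<in> W"
    proof (cases g)
      case (Tgate j)
      then have j: "j < k" using Cons.prems by auto
      show ?thesis
      proof (cases "R * Zq k j = Zq k j * R")
        case True
        then show ?thesis
          using conj_T_commute[OF j paulis_carrier[OF R]] Cons.prems(3)[of "0 # w" R] Tgate p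
          by (auto intro: pauli_branch.intros)
      next
        case False
        then have a: "R * Zq k j = - (Zq k j * R)"
          using paulis_commute_or_anticommute[OF R Zq_paulis[OF j]] by blast
        have "R \<in> W" "R * Zq k j \<in> W"
          using Cons.prems(3) pauli_branch.stay[OF p a] pauli_branch.shift[OF p a] unfolding Tgate by blast+
        then show ?thesis
          using conj_T_anticommute[OF j paulis_carrier[OF R] a] Tgate msubspace_add[OF Cons.prems(2)]
           msubspace_smult[OF Cons.prems(2)] by auto
      qed
    qed (use Cons.prems(3)[OF pauli_branch.Clifford[OF p]] in auto)
    then show "R \<in> {A \<in> carrier_mat (2^k) (2^k). conj_by ?G A \<in> W}"
      using R paulis_carrier by auto
  qed
  then show ?case
    using conj_by_compose[of "circuit_mat k C" "2^k" ?G P] paulis_carrier[OF assms(1)]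
    by (simp add: circuit_mat_Cons)
qed

text \<open>The common end of the three T cases below: a product that commutes with \<open>Z\<close>
  is left unchanged by the T gate, and the sign already present persists.\<close>

lemma conj_circuit_T_step:
  assumes "j < k" "R \<in> paulis k" "R0 \<in> paulis k" "R * R0 * Zq k j = Zq k j * (R * R0)"
    "P \<in> paulis k" "P' \<in> paulis k"
    "conj_by (circuit_mat k C) (P * P') = R * R0 \<or> conj_by (circuit_mat k C) (P * P') = - (R * R0)"
  shows "conj_by (circuit_mat k (Tgate j # C)) (P * P') = R * R0 \<or>
    conj_by (circuit_mat k (Tgate j # C)) (P * P') = - (R * R0)"
proof -
  note c = paulis_carrier[OF paulis_mult[OF assms(2,3)]] paulis_carrier[OF paulis_mult[OF assms(5,6)]]
  have "conj_by (gate_mat k (Tgate j)) (R * R0) = R * R0"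
    by (rule conj_T_commute[OF assms(1) c(1) assms(4)])
  then show ?thesis
    using assms(7) conj_by_compose[of "circuit_mat k C" "2^k" "gate_mat k (Tgate j)" "P * P'"] c
      conj_by_uminus[of "gate_mat k (Tgate j)" "2^k" "2^k" "R * R0"]
    unfolding circuit_mat_Cons by auto
qed

lemma anticommute_mult_commute:
  fixes A B Z :: "complex mat"
  assumes c: "A \<in> carrier_mat n n" "B \<in> carrier_mat n n" "Z \<in> carrier_mat n n"
    and a: "A * Z = - (Z * A)" "B * Z = - (Z * B)"
  shows "A * B * Z = Z * (A * B)"
proof -
  have "A * B * Z = A * (- (Z * B))" using c by (simp add: assoc_mult_square_mat[of _ n] a)
  also have "\<dots> = - ((A * Z) * B)" using c by (simp add: assoc_mult_square_mat[of _ n])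
  also have "\<dots> = Z * (A * B)" using c unfolding a by (simp add: assoc_mult_square_mat[of _ n])
  finally show ?thesis .
qed

lemma anticommute_shift_mult:
  fixes A B Z :: "complex mat"
  assumes c: "A \<in> carrier_mat n n" "B \<in> carrier_mat n n" "Z \<in> carrier_mat n n"
    and a: "B * Z = - (Z * B)" and Z: "Z * Z = 1\<^sub>m n"
  shows "(A * Z) * (B * Z) = - (A * B)"
proof -
  have "(A * Z) * (B * Z) = A * Z * (- (Z * B))" unfolding a ..
  also have "\<dots> = - (A * ((Z * Z) * B))" using c
    by (simp add: assoc_mult_square_mat[of _ n])
  also have "\<dots> = - (A * B)" using c unfolding Z by simp
  finally show ?thesis .
qed

text \<open>Equal words force both branches into the same alternative at every T gate, so the
  product of the operators reached so far commutes with \<open>Z\<close> and is fixed. A common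
  shift changes it only by \<open>R Z R' Z = - R R'\<close>. Single branches lose their
  coefficients, but the product is exact up to sign because it never splits.\<close>

lemma conj_circuit_branch_product:
  assumes "pauli_branch k P C w R" "pauli_branch k P' C w R'" "P \<in> paulis k" "P' \<in> paulis k"
    "\<forall>g\<in>set C. gate_wf k g"
  shows "conj_by (circuit_mat k C) (P * P') = R * R' \<or> conj_by (circuit_mat k C) (P * P') = - (R * R')"
  using assms
proof (induction arbitrary: R' rule: pauli_branch.induct)
  case Nil
  have "cadj (1\<^sub>m (2^k)) = (1\<^sub>m (2^k) :: complex mat)"
    by (rule eq_matI) (auto simp: cadj_def)
  moreover have "R' = P'" using Nil by (auto elim: pauli_branch.cases)
  ultimately show ?case using paulis_carrier[OF paulis_mult[OF Nil(2,3)]]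
    by (simp add: circuit_mat_Nil conj_by_def left_mult_one_mat[of _ "2^k" "2^k"] right_mult_one_mat[of _ "2^k" "2^k"] del: assoc_mult_mat)
next
  case (Clifford C w R g)
  let ?G = "gate_mat k g"
  from Clifford.prems(1) Clifford.hyps(2) obtain R0 where R0: "pauli_branch k P' C w R0" "R' = conj_by ?G R0"
    by (cases rule: pauli_branch.cases) auto
  have wf: "\<forall>g\<in>set C. gate_wf k g" "gate_wf k g" using Clifford by auto
  have RR: "R \<in> paulis k" "R0 \<in> paulis k"
    using pauli_branch_paulis wf Clifford.prems R0 Clifford.hyps by blast+
  note c = paulis_carrier[OF RR(1)] paulis_carrier[OF RR(2)] paulis_carrier[OF paulis_mult[OF RR]]
    paulis_carrier[OF paulis_mult[OF Clifford.prems(2,3)]]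
  have "conj_by ?G R * R' = conj_by ?G (R * R0)"
    unfolding R0 using conj_by_mult[of ?G "2^k" R R0] c gate_unitary'[OF wf(2)] by simp
  then show ?case
    using Clifford.IH[OF R0(1) Clifford.prems(2,3) wf(1)] c
      conj_by_compose[of "circuit_mat k C" "2^k" ?G "P * P'"] conj_by_uminus[of ?G "2^k" "2^k" "R * R0"]
    by (auto simp: circuit_mat_Cons)
next
  case (commute C w R j)
  from commute.prems(1) obtain R0 where R0: "pauli_branch k P' C w R0" "R' = R0" "R0 * Zq k j = Zq k j * R0"
    by (cases rule: pauli_branch.cases) auto
  have wf: "\<forall>g\<in>set C. gate_wf k g" "j < k" using commute by auto
  have RR: "R \<in> paulis k" "R0 \<in> paulis k"
    using pauli_branch_paulis wf commute.prems R0 commute.hyps by blast+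
  note c = paulis_carrier[OF RR(1)] paulis_carrier[OF RR(2)] paulis_carrier[OF Zq_paulis[OF wf(2)]]
  have "R * R0 * Zq k j = Zq k j * (R * R0)"
  proof -
    have "R * R0 * Zq k j = R * (R0 * Zq k j)" using c by (intro assoc_mult_square_mat[of _ "2^k"])
    also have "\<dots> = (R * Zq k j) * R0"
      unfolding R0(3) using c by (intro assoc_mult_square_mat[of _ "2^k", symmetric])
    also have "\<dots> = Zq k j * (R * R0)"
      unfolding commute.hyps(2) using c by (intro assoc_mult_square_mat[of _ "2^k"])
    finally show ?thesis .
  qed
  then show ?case
    using conj_circuit_T_step[OF wf(2) RR _ commute.prems(2,3) commute.IH[OF R0(1) commute.prems(2,3) wf(1)]]
    unfolding R0 by blast
next
  case (stay C w R j)
  from stay.prems(1) obtain R0 where R0: "pauli_branch k P' C w R0" "R' = R0" "R0 * Zq k j = - (Zq k j * R0)"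
    by (cases rule: pauli_branch.cases) auto
  have wf: "\<forall>g\<in>set C. gate_wf k g" "j < k" using stay by auto
  have RR: "R \<in> paulis k" "R0 \<in> paulis k"
    using pauli_branch_paulis wf stay.prems R0 stay.hyps by blast+
  note c = paulis_carrier[OF RR(1)] paulis_carrier[OF RR(2)] paulis_carrier[OF Zq_paulis[OF wf(2)]]
  have "R * R0 * Zq k j = Zq k j * (R * R0)"
    using anticommute_mult_commute[OF c stay.hyps(2) R0(3)] .
  then show ?case
    using conj_circuit_T_step[OF wf(2) RR _ stay.prems(2,3) stay.IH[OF R0(1) stay.prems(2,3) wf(1)]]
    unfolding R0 by blast
next
  case (shift C w R j)
  from shift.prems(1) obtain R0 where R0: "pauli_branch k P' C w R0" "R' = R0 * Zq k j" "R0 * Zq k j = - (Zq k j * R0)"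
    by (cases rule: pauli_branch.cases) auto
  have wf: "\<forall>g\<in>set C. gate_wf k g" "j < k" using shift by auto
  have RR: "R \<in> paulis k" "R0 \<in> paulis k"
    using pauli_branch_paulis wf shift.prems R0 shift.hyps by blast+
  note c = paulis_carrier[OF RR(1)] paulis_carrier[OF RR(2)] paulis_carrier[OF Zq_paulis[OF wf(2)]]
  have "R * R0 * Zq k j = Zq k j * (R * R0)"
    using anticommute_mult_commute[OF c shift.hyps(2) R0(3)] .
  moreover have "(R * Zq k j) * (R0 * Zq k j) = - (R * R0)"
    using anticommute_shift_mult[OF c R0(3) Zq_square[OF wf(2)]] .
  ultimately show ?case
    using conj_circuit_T_step[OF wf(2) RR _ shift.prems(2,3) shift.IH[OF R0(1) shift.prems(2,3) wf(1)]]
    unfolding R0 by auto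
qed

section \<open>Stabilizer projectors\<close>

lemma involution_mult_cancel:
  fixes A B :: "complex mat"
  assumes "A \<in> carrier_mat n n" "B \<in> carrier_mat n n" "A * A = 1\<^sub>m n"
  shows "A * (A * B) = B"
proof -
  have "A * (A * B) = (A * A) * B" using assms(1,2) by (simp add: assoc_mult_square_mat[of _ n])
  then show ?thesis using assms by simp
qed

text \<open>Toggling bit \<open>j\<close> of \<open>b\<close> is an involution on the index range
  that flips the sign of every term.\<close>

lemma sum_chi_eq_0:
  assumes "j < m" "bit z j"
  shows "(\<Sum>b<2^m. chi m z b) = 0"
proof -
  have l: "xor b (2^j) < 2^m" if "b < 2^m" for b :: nat
    using that assms by (intro xor_less_exp) auto
  have "(\<Sum>b<2^m. chi m z b) = (\<Sum>b<2^m. chi m z (xor b (2^j)))"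
    by (rule sum.reindex_bij_witness[of _ "\<lambda>b. xor b (2^j)" "\<lambda>b. xor b (2^j)"]) (auto intro: l)
  also have "\<dots> = - (\<Sum>b<2^m. chi m z b)"
    using assms by (simp add: chi_xor_right chi_exp_right sum_negf)
  finally show ?thesis by simp
qed

text \<open>A nonzero \<open>x\<close> leaves only zeros on the diagonal, and for
  \<open>x = 0\<close> the diagonal is a multiple of a character, which sums to zero unless it is
  trivial. The involution hypothesis excludes the scalars \<open>i\<close> and \<open>-i\<close>,
  whose trace is nonzero.\<close>

lemma trace_pauli_eq_0:
  assumes "P \<in> paulis m" "P * P = 1\<^sub>m (2^m)" "P \<noteq> 1\<^sub>m (2^m)" "P \<noteq> - 1\<^sub>m (2^m)"
  shows "(\<Sum>a<2^m. P $$ (a,a)) = 0"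
proof -
  obtain c x z where P: "P = pauli_mat m c x z" "x < 2^m" "z < 2^m"
    using assms(1) by (metis paulisE)
  have e: "P $$ (a,a) = (if x = 0 then \<i>^c * chi m z a else 0)" if "a < 2^m" for a
  proof -
    have "a = xor a x \<longleftrightarrow> x = 0"
      by (metis xor.commute xor_xor_cancel xor_self_eq)
    then show ?thesis using that by (simp add: P pauli_entry)
  qed
  have "\<exists>j<m. bit z j" if "x = 0"
  proof (rule ccontr)
    assume "\<not> (\<exists>j<m. bit z j)"
    then have z: "z = 0" using P by (intro exp_bit_eqI[of z m 0]) auto
    have d: "P = \<i>^c \<cdot>\<^sub>m 1\<^sub>m (2^m)"
      unfolding P z that by (rule eq_matI) (auto simp: pauli_entry)
    have "(P * P) $$ (0,0) = \<i>^c * \<i>^c"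
      unfolding P z that by (subst pauli_mult) (auto simp: pauli_entry power_add)
    then have "\<i>^c * \<i>^c = 1" using assms(2) by simp
    then have "\<i>^c = 1 \<or> \<i>^c = -1" by (simp add: square_eq_1_iff)
    moreover have "(-1) \<cdot>\<^sub>m 1\<^sub>m (2^m) = (- 1\<^sub>m (2^m) :: complex mat)" "1 \<cdot>\<^sub>m 1\<^sub>m (2^m) = (1\<^sub>m (2^m) :: complex mat)"
      by (auto intro!: eq_matI)
    ultimately show False using assms(3,4) d by auto
  qed
  then show ?thesis
    by (cases "x = 0") (auto simp: e sum_chi_eq_0 simp flip: sum_distrib_left)
qed

lemma mult_vec_entry:
  assumes "A \<in> carrier_mat p q" "v \<in> carrier_vec q" "i < p"
  shows "(A *\<^sub>v v) $ i = (\<Sum>l<q. A $$ (i,l) * v $ l)"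
  using assms by (auto simp: scalar_prod_def atLeast0LessThan intro!: sum.cong)

text \<open>A Pauli operator squares to \<open>1\<close> or \<open>-1\<close>, and \<open>S\<close>
  is closed under products without containing \<open>-1\<close>.\<close>

lemma involution_in_stabilizer:
  assumes "S \<subseteq> paulis m" "\<forall>A\<in>S. \<forall>B\<in>S. A * B \<in> S" "- 1\<^sub>m (2^m) \<notin> S" "P \<in> S"
  shows "P * P = 1\<^sub>m (2^m)"
  using assms paulis_square by (metis subsetD)

lemma pauli_involution_hermitian:
  assumes "P \<in> paulis m" "P * P = 1\<^sub>m (2^m)"
  shows "cadj P = P"
proof -
  have c: "P \<in> carrier_mat (2^m) (2^m)" using assms paulis_carrier by auto
  have "cadj P = cadj P * (P * P)" using c assms by (simp add: right_mult_one_mat[of _ "2^m" "2^m"])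
  also have "\<dots> = (cadj P * P) * P" using c by (simp add: assoc_mult_square_mat[of _ "2^m"])
  finally show ?thesis using paulis_unitary[OF assms(1)] c by simp
qed

lemma sum_norm_square_eq_0:
  fixes E :: "nat \<Rightarrow> nat \<Rightarrow> complex"
  assumes "(\<Sum>x<N. \<Sum>y<N. E x y * cnj (E x y)) = 0" "a < N" "b < N"
  shows "E a b = 0"
proof -
  have "complex_of_real (\<Sum>x<N. \<Sum>y<N. (cmod (E x y))^2) = (\<Sum>x<N. \<Sum>y<N. E x y * cnj (E x y))"
    by (simp only: of_real_sum complex_norm_square)
  then have s: "(\<Sum>x<N. \<Sum>y<N. (cmod (E x y))^2) = 0"
    using assms(1) by (simp only: of_real_eq_0_iff)
  have "(\<Sum>y<N. (cmod (E a y))^2) = 0"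
    by (rule sum_nonneg_0[where f="\<lambda>x. \<Sum>y<N. (cmod (E x y))^2" and s="{..<N}"]) (use s assms in \<open>auto intro: sum_nonneg\<close>)
  then have "(cmod (E a b))^2 = 0"
    by (rule sum_nonneg_0[where f="\<lambda>y. (cmod (E a y))^2" and s="{..<N}", rotated 2]) (use assms in auto)
  then show ?thesis by simp
qed
text \<open>The difference of the two sides is a Hermitian idempotent of trace zero.\<close>

lemma stabilizer_projector:
  assumes S: "S \<subseteq> paulis m" "1\<^sub>m (2^m) \<in> S" "\<forall>A\<in>S. \<forall>B\<in>S. A * B \<in> S"
    and card: "card S = 2^m" and neg: "- 1\<^sub>m (2^m) \<notin> S"
    and \<psi>: "\<psi> \<in> carrier_vec (2^m)" "(\<Sum>i<2^m. cmod (\<psi> $ i)^2) = 1"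
    and stab: "\<forall>P\<in>S. P *\<^sub>v \<psi> = \<psi>"
    and ab: "a < 2^m" "b < 2^m"
  shows "\<psi> $ a * cnj (\<psi> $ b) = (\<Sum>P\<in>S. 1 / 2^m * P $$ (a,b))"
proof -
  define N where "N = (2::nat)^m"
  have cN: "complex_of_nat N = 2^m" "N > 0" by (simp_all add: N_def)
  have fin: "finite S" using card by (metis card.infinite power_not_zero zero_neq_numeral)
  have car: "P \<in> carrier_mat N N" if "P \<in> S" for P using that S paulis_carrier N_def by auto
  have inv: "P * P = 1\<^sub>m N" if "P \<in> S" for P
    using involution_in_stabilizer[OF S(1,3) neg that] by (simp add: N_def)
  have herm: "cnj (P $$ (x,y)) = P $$ (y,x)" if "P \<in> S" "x < N" "y < N" for P x y
  proof -
    have "cadj P = P" using pauli_involution_hermitian[of P m] that inv S by (auto simp: N_def)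
    then show ?thesis using cadj_entry[OF car[OF that(1)] that(3,2)] by simp
  qed
  \<comment> \<open>The group average, entry by entry; the claim is that it equals
    \<open>|psi><psi|\<close>.\<close>
  define Q where "Q x y = (\<Sum>P\<in>S. P $$ (x,y)) / N" for x y
  have Qcnj: "cnj (Q x y) = Q y x" if "x < N" "y < N" for x y
    unfolding Q_def using that herm by (auto intro!: sum.cong)
  have Qidem: "(\<Sum>l<N. Q x l * Q l y) = Q x y" if "x < N" "y < N" for x y
  proof -
    have "(\<Sum>l<N. Q x l * Q l y) = (\<Sum>l<N. \<Sum>P\<in>S. \<Sum>R\<in>S. P $$ (x,l) * R $$ (l,y)) / (N * N)"
      unfolding Q_def by (simp add: sum_product sum_divide_distrib)
    also have "(\<Sum>l<N. \<Sum>P\<in>S. \<Sum>R\<in>S. P $$ (x,l) * R $$ (l,y)) =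
        (\<Sum>P\<in>S. \<Sum>l<N. \<Sum>R\<in>S. P $$ (x,l) * R $$ (l,y))"
      by (rule sum.swap)
    also have "\<dots> = (\<Sum>P\<in>S. \<Sum>R\<in>S. \<Sum>l<N. P $$ (x,l) * R $$ (l,y))"
      by (rule sum.cong[OF refl], rule sum.swap)
    also have "\<dots> = (\<Sum>P\<in>S. \<Sum>R\<in>S. (P * R) $$ (x,y))"
      using that by (intro sum.cong refl mat_mult_entry[symmetric]) (auto intro: car)
    also have "\<dots> = (\<Sum>P\<in>S. \<Sum>R\<in>S. R $$ (x,y))"
    proof (rule sum.cong[OF refl])
      fix P assume P: "P \<in> S"
      have c: "P * (P * R) = R" if "R \<in> S" for R
        using involution_mult_cancel[OF car[OF P] car[OF that] inv[OF P]] .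
      \<comment> \<open>Multiplication by \<open>P\<close> permutes \<open>S\<close> and is its own
        inverse.\<close>
      show "(\<Sum>R\<in>S. (P * R) $$ (x,y)) = (\<Sum>R\<in>S. R $$ (x,y))"
        by (rule sum.reindex_bij_witness[of _ "\<lambda>R. P * R" "\<lambda>R. P * R"]) (use S P c in auto)
    qed
    also have "\<dots> = N * (\<Sum>R\<in>S. R $$ (x,y))" using card by (simp add: N_def)
    finally show ?thesis using cN by (simp add: Q_def)
  qed
  have Qtrace: "(\<Sum>x<N. Q x x) = 1"
  proof -
    have "(\<Sum>x<N. Q x x) = (\<Sum>P\<in>S. \<Sum>x<N. P $$ (x,x)) / N"
      unfolding Q_def sum_divide_distrib[symmetric] by (subst sum.swap) simp
    also have "(\<Sum>P\<in>S. \<Sum>x<N. P $$ (x,x)) = (\<Sum>P\<in>{1\<^sub>m N}. \<Sum>x<N. P $$ (x,x))"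
    proof (rule sum.mono_neutral_right[OF fin])
      show "{1\<^sub>m N} \<subseteq> S" using S by (simp add: N_def)
      show "\<forall>P\<in>S - {1\<^sub>m N}. (\<Sum>x<N. P $$ (x,x)) = 0"
        using trace_pauli_eq_0[of _ m] S inv neg unfolding N_def by blast
    qed
    also have "\<dots> = N" by simp
    finally show ?thesis using cN by simp
  qed
  have Qfix: "(\<Sum>y<N. Q x y * \<psi> $ y) = \<psi> $ x" if "x < N" for x
  proof -
    have "(\<Sum>y<N. Q x y * \<psi> $ y) = (\<Sum>P\<in>S. \<Sum>y<N. P $$ (x,y) * \<psi> $ y) / N"
      unfolding Q_def by (subst sum.swap) (simp add: sum_divide_distrib sum_distrib_right)
    also have "(\<Sum>P\<in>S. \<Sum>y<N. P $$ (x,y) * \<psi> $ y) = (\<Sum>P\<in>S. \<psi> $ x)"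
    proof (rule sum.cong[OF refl])
      fix P assume "P \<in> S"
      then show "(\<Sum>y<N. P $$ (x,y) * \<psi> $ y) = \<psi> $ x"
        using mult_vec_entry[OF car, of P \<psi> x] \<psi> stab that by (simp add: N_def)
    qed
    also have "\<dots> = N * \<psi> $ x" using card by (simp add: N_def)
    finally show ?thesis using cN by simp
  qed
  have norm: "(\<Sum>x<N. \<psi> $ x * cnj (\<psi> $ x)) = 1"
  proof -
    have "(\<Sum>x<N. \<psi> $ x * cnj (\<psi> $ x)) = of_real (\<Sum>i<N. cmod (\<psi> $ i)^2)"
      by (simp add: complex_norm_square[symmetric])
    then show ?thesis using \<psi> by (simp add: N_def)
  qed
  define E where "E x y = Q x y - \<psi> $ x * cnj (\<psi> $ y)" for x y
  \<comment> \<open>The squared Frobenius norm of \<open>E\<close> is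
    \<open>tr (Q Q) - 2 <psi|Q|psi> + 1\<close>, which is \<open>1 - 2 + 1 = 0\<close> by
    \<open>Qidem\<close>, \<open>Qtrace\<close> and \<open>Qfix\<close>.\<close>
  have "(\<Sum>x<N. \<Sum>y<N. E x y * cnj (E x y)) =
     (\<Sum>x<N. \<Sum>y<N. Q x y * Q y x - cnj (\<psi> $ x) * (Q x y * \<psi> $ y) - cnj (\<psi> $ y) * (Q y x * \<psi> $ x)
       + (\<psi> $ x * cnj (\<psi> $ x)) * (\<psi> $ y * cnj (\<psi> $ y)))"
    by (intro sum.cong refl) (auto simp: E_def Qcnj algebra_simps)
  also have "\<dots> = (\<Sum>x<N. \<Sum>y<N. Q x y * Q y x) - (\<Sum>x<N. cnj (\<psi> $ x) * (\<Sum>y<N. Q x y * \<psi> $ y))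
      - (\<Sum>x<N. \<Sum>y<N. cnj (\<psi> $ y) * (Q y x * \<psi> $ x))
      + (\<Sum>x<N. \<psi> $ x * cnj (\<psi> $ x)) * (\<Sum>y<N. \<psi> $ y * cnj (\<psi> $ y))"
    by (subst sum_product) (simp add: sum.distrib sum_subtractf sum_distrib_left)
  also have "(\<Sum>x<N. \<Sum>y<N. cnj (\<psi> $ y) * (Q y x * \<psi> $ x)) = (\<Sum>y<N. cnj (\<psi> $ y) * (\<Sum>x<N. Q y x * \<psi> $ x))"
    by (subst sum.swap) (simp add: sum_distrib_left)
  finally have "(\<Sum>x<N. \<Sum>y<N. E x y * cnj (E x y)) = 0"
    using Qidem Qtrace Qfix norm by (simp add: mult.commute)
  then have "E a b = 0" by (rule sum_norm_square_eq_0) (use ab in \<open>simp_all add: N_def\<close>)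
  then show ?thesis using cN by (simp add: E_def Q_def sum_divide_distrib)
qed

section \<open>Products of commuting generators and the stabilizer basis\<close>

lemma mprod_filter_commute:
  assumes "\<And>j. j \<in> set js \<Longrightarrow> g j \<in> carrier_mat (2^k) (2^k)" "h \<in> carrier_mat (2^k) (2^k)"
    "\<And>j. j \<in> set js \<Longrightarrow> h * g j = g j * h"
  shows "h * mprod k (map g (filter P js)) = mprod k (map g (filter P js)) * h"
  using assms
proof (induction js)
  case (Cons j js)
  let ?M = "mprod k (map g (filter P js))"
  have M: "?M \<in> carrier_mat (2^k) (2^k)" using Cons.prems by (intro mprod_carrier) auto
  have IH: "h * ?M = ?M * h" using Cons by auto
  have c: "g j \<in> carrier_mat (2^k) (2^k)" "h * g j = g j * h" using Cons.prems by auto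
  have "h * (g j * ?M) = (h * g j) * ?M"
    using c M Cons.prems(2) by (intro assoc_mult_square_mat[of _ "2^k", symmetric])
  also have "\<dots> = g j * (h * ?M)" unfolding c(2) using c(1) M Cons.prems(2) by (intro assoc_mult_square_mat[of _ "2^k"])
  also have "\<dots> = g j * ?M * h" unfolding IH using c(1) M Cons.prems(2) by (intro assoc_mult_square_mat[of _ "2^k", symmetric])
  finally show ?case using IH by simp
qed simp

text \<open>Products of commuting involutions multiply like subsets under symmetric difference: a
  generator in both \<open>A\<close> and \<open>B\<close> occurs twice and cancels.\<close>

lemma mprod_filter_mult:
  assumes "\<And>j. j \<in> set js \<Longrightarrow> g j \<in> carrier_mat (2^k) (2^k)"
    "\<And>j. j \<in> set js \<Longrightarrow> g j * g j = 1\<^sub>m (2^k)"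
    "\<And>i j. i \<in> set js \<Longrightarrow> j \<in> set js \<Longrightarrow> g i * g j = g j * g i"
  shows "mprod k (map g (filter (\<lambda>j. j \<in> A) js)) * mprod k (map g (filter (\<lambda>j. j \<in> B) js)) =
     mprod k (map g (filter (\<lambda>j. j \<in> (A - B) \<union> (B - A)) js))"
  using assms
proof (induction js)
  case (Cons j js)
  define M where "M X = mprod k (map g (filter (\<lambda>j. j \<in> X) js))" for X
  have M: "M X \<in> carrier_mat (2^k) (2^k)" for X
    unfolding M_def using Cons.prems by (intro mprod_carrier) auto
  have g: "g j \<in> carrier_mat (2^k) (2^k)" "g j * g j = 1\<^sub>m (2^k)" using Cons.prems by auto
  have com: "g j * M X = M X * g j" for X
    unfolding M_def using Cons.prems by (intro mprod_filter_commute) auto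
  have IH: "M A * M B = M ((A - B) \<union> (B - A))" unfolding M_def using Cons by auto
  have 1: "M A * (g j * M B) = g j * (M A * M B)"
  proof -
    have "M A * (g j * M B) = (M A * g j) * M B"
      using M g by (intro assoc_mult_square_mat[of _ "2^k", symmetric]) auto
    also have "\<dots> = g j * (M A * M B)"
      unfolding com[symmetric] using M g by (intro assoc_mult_square_mat[of _ "2^k"]) auto
    finally show ?thesis .
  qed
  have 2: "g j * (g j * X) = X" if "X \<in> carrier_mat (2^k) (2^k)" for X
    using involution_mult_cancel[OF g(1) that g(2)] .
  have "(if j \<in> A then g j * M A else M A) * (if j \<in> B then g j * M B else M B) =
    (if j \<in> (A - B) \<union> (B - A) then g j * M ((A - B) \<union> (B - A)) else M ((A - B) \<union> (B - A)))"
    using M g by (auto simp: assoc_mult_square_mat[of _ "2^k"] 1 2 IH)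
  then show ?case unfolding M_def by auto
qed simp

lemma mprod_paulis: "(\<And>A. A \<in> set As \<Longrightarrow> A \<in> paulis k) \<Longrightarrow> mprod k As \<in> paulis k"
  by (induction As) (auto intro: paulis_mult paulis_one)

lemma mprod_eigenvector:
  assumes "\<And>A. A \<in> set As \<Longrightarrow> A \<in> carrier_mat (2^k) (2^k)" "v \<in> carrier_vec (2^k)"
    "\<And>A. A \<in> set As \<Longrightarrow> \<exists>e. A *\<^sub>v v = e \<cdot>\<^sub>v v"
  shows "\<exists>e. mprod k As *\<^sub>v v = e \<cdot>\<^sub>v v"
  using assms
proof (induction As)
  case Nil
  have "mprod k [] *\<^sub>v v = 1 \<cdot>\<^sub>v v" using Nil by simp
  then show ?case by blast
next
  case (Cons A As)
  obtain e f where "mprod k As *\<^sub>v v = e \<cdot>\<^sub>v v" "A *\<^sub>v v = f \<cdot>\<^sub>v v" using Cons by force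
  moreover have "(A * mprod k As) *\<^sub>v v = A *\<^sub>v (mprod k As *\<^sub>v v)"
    using Cons.prems by (intro assoc_mult_mat_vec[of _ "2^k" "2^k" _ "2^k"] mprod_carrier) auto
  ultimately have "(A * mprod k As) *\<^sub>v v = (e * f) \<cdot>\<^sub>v v"
    using Cons.prems mult_mat_vec[of A "2^k" "2^k" v e] by (simp add: smult_smult_assoc)
  then show ?case by auto
qed

text \<open>All \<Phi> b are eigenvectors of the same products of generators and differ in the
  eigenvalue signs. Multiplying each product by its sign for \<open>b\<close> gives a stabilizer
  group of \<Phi> b, to which \<open>stabilizer_projector\<close> applies. One commuting set
  \<open>L\<close> has to serve all \<open>b\<close>, because branches from different projectors are
  compared later.\<close>

lemma stabilizer_basis_expand:
  assumes sb: "stabilizer_basis k \<Phi>"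
  shows "\<exists>L\<subseteq>paulis k. (\<forall>P\<in>L. \<forall>Q\<in>L. P * Q = Q * P) \<and>
    (\<forall>b<2^k. \<exists>S\<subseteq>L. finite S \<and>
       (\<forall>a<2^k. \<forall>a'<2^k. \<Phi> b $ a * cnj (\<Phi> b $ a') = (\<Sum>P\<in>S. 1 / 2^k * P $$ (a,a'))))"
proof -
  define N where "N = (2::nat)^k"
  from sb obtain gs where gs: "length gs = k" "\<forall>g\<in>set gs. g \<in> paulis k \<and> cadj g = g"
     "\<forall>g\<in>set gs. \<forall>h\<in>set gs. g * h = h * g"
     "\<forall>A\<subseteq>{..<k}. A \<noteq> {} \<longrightarrow>
            \<not> (\<exists>c. mprod k (map (\<lambda>j. gs ! j) (filter (\<lambda>j. j \<in> A) [0..<k])) = c \<cdot>\<^sub>m 1\<^sub>m (2^k))"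
     "\<forall>b<2^k. \<forall>g\<in>set gs. \<exists>ev. g *\<^sub>v \<Phi> b = ev \<cdot>\<^sub>v \<Phi> b"
    unfolding stabilizer_basis_def by (elim conjE exE) (rule that)
  from sb have \<Phi>: "\<And>b. b < 2^k \<Longrightarrow> \<Phi> b \<in> carrier_vec (2^k)"
    "\<And>b. b < 2^k \<Longrightarrow> (\<Sum>i<2^k. \<Phi> b $ i * cnj (\<Phi> b $ i)) = 1"
    unfolding stabilizer_basis_def by auto
  define M where "M A = mprod k (map (\<lambda>j. gs ! j) (filter (\<lambda>j. j \<in> A) [0..<k]))" for A
  have g: "gs ! j \<in> paulis k" "gs ! j * gs ! j = 1\<^sub>m (2^k)" "gs ! j \<in> carrier_mat (2^k) (2^k)"
    if "j \<in> set [0..<k]" for j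
  proof -
    have "gs ! j \<in> set gs" using that gs by auto
    \<comment> \<open>The generators are self-adjoint and unitary, hence involutions.\<close>
    then show "gs ! j \<in> paulis k" "gs ! j * gs ! j = 1\<^sub>m (2^k)" "gs ! j \<in> carrier_mat (2^k) (2^k)"
      using gs(2) paulis_unitary paulis_carrier by metis+
  qed
  have gcom: "gs ! i * gs ! j = gs ! j * gs ! i" if "i \<in> set [0..<k]" "j \<in> set [0..<k]" for i j
    using that gs by auto
  have Mp: "M A \<in> paulis k" for A unfolding M_def by (rule mprod_paulis) (use g in auto)
  have Mc: "M A \<in> carrier_mat (2^k) (2^k)" for A using Mp paulis_carrier by blast
  have Mmult: "M A * M B = M ((A - B) \<union> (B - A))" for A B
    unfolding M_def by (rule mprod_filter_mult) (use g gcom in auto)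
  have Mcom: "M A * M B = M B * M A" for A B unfolding Mmult by (simp add: Un_commute)
  have Memp: "M {} = 1\<^sub>m (2^k)" by (simp add: M_def)
  have Msq: "M A * M A = 1\<^sub>m (2^k)" for A by (simp add: Mmult Memp)
  \<comment> \<open>Both signs are included because the sign in front of \<open>M A\<close> depends
    on \<open>b\<close>.\<close>
  define L where "L = {P. \<exists>A. P = M A \<or> P = - M A}"
  have "L \<subseteq> paulis k" unfolding L_def by (auto intro: Mp paulis_uminus)
  moreover have "P * Q = Q * P" if PQ: "P \<in> L" "Q \<in> L" for P Q
  proof -
    obtain A where "P = M A \<or> P = - M A" using PQ(1) unfolding L_def by blast
    moreover obtain B where "Q = M B \<or> Q = - M B" using PQ(2) unfolding L_def by blast
    ultimately show ?thesis using Mc[of A] Mc[of B] by (elim disjE) (simp_all add: Mcom[of A B])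
  qed
  moreover have "\<exists>S\<subseteq>L. finite S \<and>
       (\<forall>a<2^k. \<forall>a'<2^k. \<Phi> b $ a * cnj (\<Phi> b $ a') = (\<Sum>P\<in>S. 1 / 2^k * P $$ (a,a')))"
    if b: "b < 2^k" for b
  proof -
    define v where "v = \<Phi> b"
    have v: "v \<in> carrier_vec (2^k)" "(\<Sum>i<2^k. v $ i * cnj (v $ i)) = 1"
      using \<Phi> b by (auto simp: v_def)
    have vn: "(\<Sum>i<2^k. cmod (v $ i)^2) = 1"
    proof -
      have "complex_of_real (\<Sum>i<2^k. cmod (v $ i)^2) = 1"
        using v(2) by (simp add: complex_norm_square[symmetric])
      then show ?thesis by (metis of_real_eq_1_iff)
    qed
    \<comment> \<open>A nonzero component, from which a scalar can be recovered when its multiple of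
      \<open>v\<close> is known.\<close>
    obtain i where i: "i < 2^k" "v $ i \<noteq> 0"
    proof -
      have "\<exists>i<2^k. v $ i \<noteq> 0"
      proof (rule ccontr)
        assume "\<not> ?thesis"
        then have "(\<Sum>i<2^k. v $ i * cnj (v $ i)) = 0" by (intro sum.neutral) auto
        then show False using v by simp
      qed
      then show ?thesis using that by blast
    qed
    have smult_inj: "e = f" if "e \<cdot>\<^sub>v v = f \<cdot>\<^sub>v v" for e f
    proof -
      have "(e \<cdot>\<^sub>v v) $ i = (f \<cdot>\<^sub>v v) $ i" using that by simp
      then show ?thesis using i v by auto
    qed
    have "\<exists>e. M A *\<^sub>v v = e \<cdot>\<^sub>v v" for A
      unfolding M_def by (rule mprod_eigenvector) (use g v b gs in \<open>auto simp: v_def\<close>)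
    then obtain e where e: "\<And>A. M A *\<^sub>v v = e A \<cdot>\<^sub>v v" by metis
    \<comment> \<open>The eigenvalues obey the product rule of \<open>M\<close>, so they are signs,
      and the rescaled products \<open>G\<close> below obey it too.\<close>
    have emult: "e A * e B = e ((A - B) \<union> (B - A))" for A B
    proof (rule smult_inj)
      have "e ((A - B) \<union> (B - A)) \<cdot>\<^sub>v v = (M A * M B) *\<^sub>v v" unfolding Mmult e ..
      also have "\<dots> = M A *\<^sub>v (M B *\<^sub>v v)" using Mc v by (intro assoc_mult_mat_vec)
      also have "\<dots> = (e B * e A) \<cdot>\<^sub>v v"
        unfolding e using mult_mat_vec[OF Mc v(1)] by (simp add: e smult_smult_assoc)
      finally show "(e A * e B) \<cdot>\<^sub>v v = e ((A - B) \<union> (B - A)) \<cdot>\<^sub>v v" by (simp add: mult.commute)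
    qed
    have e1: "e {} = 1"
      by (rule smult_inj) (use e[of "{}"] v in \<open>simp add: Memp\<close>)
    have esq: "e A * e A = 1" for A using emult[of A A] e1 by simp
    define G where "G A = e A \<cdot>\<^sub>m M A" for A
    have Gpm: "G A = M A \<or> G A = - M A" for A
    proof -
      have "e A = 1 \<or> e A = -1" using esq[of A] by (simp add: square_eq_1_iff)
      then show ?thesis unfolding G_def by (auto intro!: eq_matI)
    qed
    have GL: "G A \<in> L" for A using Gpm by (auto simp: L_def)
    have Gp: "G A \<in> paulis k" for A using GL \<open>L \<subseteq> paulis k\<close> by blast
    have Gmult: "G A * G B = G ((A - B) \<union> (B - A))" for A B
    proof -
      have "G A * G B = e A \<cdot>\<^sub>m (e B \<cdot>\<^sub>m (M A * M B))"
        unfolding G_def using Mc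
        by (metis mult_smult_assoc_mat mult_smult_distrib smult_carrier_mat)
      also have "\<dots> = (e A * e B) \<cdot>\<^sub>m (M A * M B)" by (rule eq_matI) auto
      finally show ?thesis by (simp add: G_def Mmult emult)
    qed
    have Gv: "G A *\<^sub>v v = v" for A
    proof -
      have "G A *\<^sub>v v = e A \<cdot>\<^sub>v (M A *\<^sub>v v)"
        unfolding G_def using Mc[of A] v by (intro eq_vecI) (auto simp: smult_scalar_prod_distrib)
      then show ?thesis using v by (simp add: e smult_smult_assoc esq)
    qed
    have Gemp: "G {} = 1\<^sub>m (2^k)" unfolding G_def e1 Memp by (rule eq_matI) auto
    define S where "S = G ` Pow {..<k}"
    have inj: "inj_on G (Pow {..<k})"
    proof (rule inj_onI, rule ccontr)
      fix A B assume A: "A \<in> Pow {..<k}" and B: "B \<in> Pow {..<k}" and "G A = G B" and "A \<noteq> B"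
      let ?D = "(A - B) \<union> (B - A)"
      \<comment> \<open>If \<open>G A = G B\<close>, the generators in the symmetric difference
        multiply to a scalar, against their independence. Hence \<open>S\<close> has all
        \<open>2^k\<close> elements.\<close>
      have "G ?D = G {}" using Gmult[of A B] Gmult[of B B] \<open>G A = G B\<close> by simp
      then have "M ?D = 1\<^sub>m (2^k) \<or> - M ?D = 1\<^sub>m (2^k)" using Gpm[of ?D] Gemp by metis
      then have "M ?D = 1 \<cdot>\<^sub>m 1\<^sub>m (2^k) \<or> M ?D = (-1) \<cdot>\<^sub>m 1\<^sub>m (2^k)"
      proof
        assume "- M ?D = 1\<^sub>m (2^k)"
        then have "- (- M ?D) = (-1) \<cdot>\<^sub>m 1\<^sub>m (2^k)" by (auto intro!: eq_matI)
        then show ?thesis by simp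
      qed (auto intro!: eq_matI)
      moreover have "?D \<subseteq> {..<k}" "?D \<noteq> {}" using A B \<open>A \<noteq> B\<close> by auto
      ultimately show False using gs(4) unfolding M_def by blast
    qed
    have 1: "S \<subseteq> paulis k" using Gp by (auto simp: S_def)
    have "G {} \<in> S" unfolding S_def by (rule imageI) simp
    then have 2: "1\<^sub>m (2^k) \<in> S" unfolding Gemp .
    have 3: "\<forall>A\<in>S. \<forall>B\<in>S. A * B \<in> S"
    proof (intro ballI)
      fix X Y assume "X \<in> S" "Y \<in> S"
      then obtain A B where "X = G A" "Y = G B" "A \<in> Pow {..<k}" "B \<in> Pow {..<k}"
        unfolding S_def by blast
      then show "X * Y \<in> S" unfolding S_def by (auto simp only: Gmult intro!: imageI)
    qed
    have 4: "card S = 2^k" unfolding S_def by (simp add: card_image[OF inj] card_Pow)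
    have 5: "\<forall>P\<in>S. P *\<^sub>v v = v" using Gv by (auto simp: S_def)
    have 6: "- 1\<^sub>m (2^k) \<notin> S"
    proof
      assume "- 1\<^sub>m (2^k) \<in> S"
      then have "(- 1\<^sub>m (2^k)) *\<^sub>v v = v" using 5 by blast
      moreover have "((- 1\<^sub>m (2^k)) *\<^sub>v v) $ i = (\<Sum>l<2^k. (- 1\<^sub>m (2^k)) $$ (i,l) * v $ l)"
        using v i by (intro mult_vec_entry) auto
      moreover have "(\<Sum>l<2^k. (- 1\<^sub>m (2^k)) $$ (i,l) * v $ l) = (\<Sum>l\<in>{i}. - v $ l)"
        by (rule sum.mono_neutral_cong_right) (use i in auto)
      ultimately have "v $ i = - v $ i" by simp
      then show False using i by simp
    qed
    have "\<Phi> b $ a * cnj (\<Phi> b $ a') = (\<Sum>P\<in>S. 1 / 2^k * P $$ (a,a'))" if "a < 2^k" "a' < 2^k" for a a'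
      using stabilizer_projector[OF 1 2 3 4 6 v(1) vn 5 that] by (simp add: v_def)
    moreover have "S \<subseteq> L" "finite S" using GL by (auto simp: S_def)
    ultimately show ?thesis by blast
  qed
  ultimately show ?thesis by blast
qed

section \<open>Compression to the data qubits\<close>

text \<open>The isometry \<open>I (x) |psi>\<close>, the \<open>V\<close> of the overview. An index
  \<open>r\<close> holds the data qubits in \<open>r mod 2^n\<close> and the ancillas in
  \<open>r div 2^n\<close>.\<close>

definition ancilla_iso :: "nat \<Rightarrow> nat \<Rightarrow> complex vec \<Rightarrow> complex mat" where
  "ancilla_iso n m \<psi> = mat (2^(n+m)) (2^n) (\<lambda>(r,a). if r mod 2^n = a then \<psi> $ (r div 2^n) else 0)"

text \<open>The operator \<open>I (x) P\<close>, acting on the ancillas only.\<close>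

definition ancilla_lift :: "nat \<Rightarrow> nat \<Rightarrow> complex mat \<Rightarrow> complex mat" where
  "ancilla_lift n m P = mat (2^(n+m)) (2^(n+m))
     (\<lambda>(r,s). if r mod 2^n = s mod 2^n then P $$ (r div 2^n, s div 2^n) else 0)"

lemma ancilla_iso_carrier [simp]: "ancilla_iso n m \<psi> \<in> carrier_mat (2^(n+m)) (2^n)"
  by (simp add: ancilla_iso_def)

lemma ancilla_lift_carrier [simp]: "ancilla_lift n m P \<in> carrier_mat (2^(n+m)) (2^(n+m))"
  by (simp add: ancilla_lift_def)

lemma div_less_exp: "r < 2^(n+m) \<Longrightarrow> r div 2^n < (2::nat)^m"
  by (simp add: power_add less_mult_imp_div_less mult.commute)

lemma join_less_exp: "a < 2^n \<Longrightarrow> c < 2^m \<Longrightarrow> a + 2^n * c < (2::nat)^(n+m)"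
proof -
  assume "a < 2^n" "c < (2::nat)^m"
  then have "a + 2^n * c < 2^n * Suc c" "2^n * Suc c \<le> 2^n * 2^m" by (simp, intro mult_le_mono) auto
  then show ?thesis by (simp add: power_add)
qed

lemma sum_register_split:
  fixes f :: "nat \<Rightarrow> complex"
  shows "(\<Sum>r<2^(n+m). f r) = (\<Sum>c<2^m. \<Sum>a<2^n. f (a + 2^n * c))"
proof -
  have "(\<Sum>c<2^m. \<Sum>a<2^n. f (a + 2^n * c)) = (\<Sum>(c,a)\<in>{..<2^m} \<times> {..<2^n}. f (a + 2^n * c))"
    by (rule sum.cartesian_product)
  also have "\<dots> = (\<Sum>r<2^(n+m). f r)"
    by (rule sum.reindex_bij_witness[of _ "\<lambda>r. (r div 2^n, r mod 2^n)" "\<lambda>(c,a). a + 2^n * c"])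
       (auto simp: join_less_exp div_less_exp)
  finally show ?thesis by simp
qed

lemma prod_add_split:
  fixes f :: "nat \<Rightarrow> complex"
  shows "(\<Prod>j<n+m. f j) = (\<Prod>j<n. f j) * (\<Prod>j<m. f (n + j))"
  by (induction m) (auto simp: mult.assoc)

text \<open>The labels move to the ancilla positions, and the \<open>n\<close> data qubits
  contribute trivial factors to \<open>chi\<close>. As Pauli operators, lifted stabilizers commute
  or anticommute with every \<open>R\<close> in \<open>paulis (n+m)\<close>.\<close>

lemma ancilla_lift_pauli:
  assumes "x < 2^m" "z < 2^m"
  shows "ancilla_lift n m (pauli_mat m c x z) = pauli_mat (n+m) c (push_bit n x) (push_bit n z)"
proof (rule eq_matI)
  fix r s assume "r < dim_row (pauli_mat (n+m) c (push_bit n x) (push_bit n z))"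
    "s < dim_col (pauli_mat (n+m) c (push_bit n x) (push_bit n z))"
  then have rs: "r < 2^(n+m)" "s < 2^(n+m)" by auto
  have 1: "chi (n+m) (push_bit n z) s = chi m z (s div 2^n)"
    unfolding chi_def prod_add_split
    by (simp add: bit_push_bit_iff bit_drop_bit_eq flip: drop_bit_eq_div)
  have 2: "r = xor s (push_bit n x) \<longleftrightarrow> r mod 2^n = s mod 2^n \<and> r div 2^n = xor (s div 2^n) x"
  proof
    assume "r = xor s (push_bit n x)"
    then show "r mod 2^n = s mod 2^n \<and> r div 2^n = xor (s div 2^n) x"
      unfolding take_bit_eq_mod[symmetric] drop_bit_eq_div[symmetric]
      by (auto intro!: bit_eqI simp: bit_simps)
  next
    assume "r mod 2^n = s mod 2^n \<and> r div 2^n = xor (s div 2^n) x"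
    then have h: "take_bit n r = take_bit n s" "drop_bit n r = xor (drop_bit n s) x"
      by (simp_all add: take_bit_eq_mod drop_bit_eq_div)
    show "r = xor s (push_bit n x)"
    proof (rule bit_eqI)
      fix j
      show "bit r j = bit (xor s (push_bit n x)) j"
      proof (cases "j < n")
        case True
        have "bit (take_bit n r) j = bit (take_bit n s) j" using h by simp
        then show ?thesis using True by (simp add: bit_simps)
      next
        case False
        then obtain i where j: "j = n + i" using le_Suc_ex not_less by blast
        have "bit (drop_bit n r) i = bit (xor (drop_bit n s) x) i" using h by simp
        then show ?thesis by (simp add: j bit_simps)
      qed
    qed
  qed
  show "ancilla_lift n m (pauli_mat m c x z) $$ (r,s) = pauli_mat (n+m) c (push_bit n x) (push_bit n z) $$ (r,s)"
    using rs pauli_entry[OF div_less_exp[OF rs(1)] div_less_exp[OF rs(2)], of c x z]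
    by (cases "r div 2^n = xor (s div 2^n) x") (simp_all add: ancilla_lift_def pauli_entry 1 2)
qed (auto simp: ancilla_lift_def)

lemma ancilla_lift_paulis:
  assumes "P \<in> paulis m" shows "ancilla_lift n m P \<in> paulis (n+m)"
proof -
  obtain c x z where P: "P = pauli_mat m c x z" "x < 2^m" "z < 2^m"
    using assms by (metis paulisE)
  have "push_bit n x < 2^(n+m)" "push_bit n z < 2^(n+m)"
    using P by (simp_all add: push_bit_eq_mult power_add)
  then show ?thesis unfolding P(1) ancilla_lift_pauli[OF P(2,3)] by (rule paulisI)
qed

lemma ancilla_lift_cadj:
  "P \<in> carrier_mat (2^m) (2^m) \<Longrightarrow> cadj (ancilla_lift n m P) = ancilla_lift n m (cadj P)"
  by (rule eq_matI) (auto simp: ancilla_lift_def cadj_def div_less_exp)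

lemma ancilla_iso_isometry:
  assumes "(\<Sum>i<2^m. cmod (\<psi> $ i)^2) = 1"
  shows "cadj (ancilla_iso n m \<psi>) * ancilla_iso n m \<psi> = 1\<^sub>m (2^n)"
proof (rule eq_matI)
  fix a b assume "a < dim_row (1\<^sub>m (2^n) :: complex mat)" "b < dim_col (1\<^sub>m (2^n) :: complex mat)"
  then have ab: "a < 2^n" "b < 2^n" by auto
  let ?V = "ancilla_iso n m \<psi>"
  have "(cadj ?V * ?V) $$ (a,b) = (\<Sum>r<2^(n+m). cadj ?V $$ (a,r) * ?V $$ (r,b))"
    using ab by (intro mat_mult_entry) auto
  also have "\<dots> = (\<Sum>r<2^(n+m). cnj (?V $$ (r,a)) * ?V $$ (r,b))"
    using ab by (intro sum.cong refl) (auto simp: cadj_entry[of _ "2^(n+m)" "2^n"])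
  also have "\<dots> = (\<Sum>c<2^m. \<Sum>d<2^n. if a = d then (if a = b then cnj (\<psi> $ c) * \<psi> $ c else 0) else 0)"
    unfolding sum_register_split using ab
    by (intro sum.cong refl) (auto simp: ancilla_iso_def join_less_exp)
  also have "\<dots> = (if a = b then \<Sum>c<2^m. cnj (\<psi> $ c) * \<psi> $ c else 0)"
    using ab by simp
  also have "(\<Sum>c<2^m. cnj (\<psi> $ c) * \<psi> $ c) = of_real (\<Sum>i<2^m. cmod (\<psi> $ i)^2)"
    by (simp add: complex_norm_square[symmetric] mult.commute)
  finally show "(cadj ?V * ?V) $$ (a,b) = 1\<^sub>m (2^n) $$ (a,b)" using ab assms by simp
qed (auto simp: ancilla_iso_def cadj_def)

lemma ancilla_lift_mult_iso:
  assumes P: "P \<in> carrier_mat (2^m) (2^m)" and \<psi>: "\<psi> \<in> carrier_vec (2^m)" and fixed: "P *\<^sub>v \<psi> = \<psi>"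
  shows "ancilla_lift n m P * ancilla_iso n m \<psi> = ancilla_iso n m \<psi>"
proof (rule eq_matI)
  let ?V = "ancilla_iso n m \<psi>" and ?L = "ancilla_lift n m P"
  fix r b assume "r < dim_row ?V" "b < dim_col ?V"
  then have rb: "r < 2^(n+m)" "b < 2^n" by (auto simp: ancilla_iso_def)
  have "(?L * ?V) $$ (r,b) = (\<Sum>s<2^(n+m). ?L $$ (r,s) * ?V $$ (s,b))"
    using rb by (intro mat_mult_entry) auto
  also have "\<dots> = (\<Sum>c<2^m. \<Sum>d<2^n. if b = d then (if r mod 2^n = b then P $$ (r div 2^n, c) * \<psi> $ c else 0) else 0)"
    unfolding sum_register_split using rb
    by (intro sum.cong refl) (auto simp: ancilla_iso_def ancilla_lift_def join_less_exp)
  also have "\<dots> = (if r mod 2^n = b then \<Sum>c<2^m. P $$ (r div 2^n, c) * \<psi> $ c else 0)"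
    using rb by simp
  also have "(\<Sum>c<2^m. P $$ (r div 2^n, c) * \<psi> $ c) = \<psi> $ (r div 2^n)"
    using mult_vec_entry[OF P \<psi> div_less_exp[OF rb(1)]] fixed by simp
  finally show "(?L * ?V) $$ (r,b) = ?V $$ (r,b)" using rb by (simp add: ancilla_iso_def)
qed (auto simp: ancilla_iso_def ancilla_lift_def)

text \<open>The left side is \<open>I (x) |psi><psi|\<close>, so the expansion of
  \<open>|psi><psi|\<close> lifts term by term. What commutes with all lifted stabilizers therefore
  commutes with it.\<close>

lemma ancilla_iso_range_projector:
  assumes "\<And>a b. a < 2^m \<Longrightarrow> b < 2^m \<Longrightarrow> \<psi> $ a * cnj (\<psi> $ b) = (\<Sum>P\<in>S. 1 / 2^m * P $$ (a,b))"
  shows "ancilla_iso n m \<psi> * cadj (ancilla_iso n m \<psi>) =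
    mat (2^(n+m)) (2^(n+m)) (\<lambda>p. \<Sum>P\<in>S. 1 / 2^m * ancilla_lift n m P $$ p)"
proof (rule eq_matI)
  let ?V = "ancilla_iso n m \<psi>" and ?R = "mat (2^(n+m)) (2^(n+m)) (\<lambda>p. \<Sum>P\<in>S. 1 / 2^m * ancilla_lift n m P $$ p)"
  fix r s assume "r < dim_row ?R" "s < dim_col ?R"
  then have rs: "r < 2^(n+m)" "s < 2^(n+m)" by auto
  have "(?V * cadj ?V) $$ (r,s) = (\<Sum>l<2^n. ?V $$ (r,l) * cadj ?V $$ (l,s))"
    using rs by (intro mat_mult_entry) auto
  also have "\<dots> = (\<Sum>l<2^n. if r mod 2^n = l then (if r mod 2^n = s mod 2^n then \<psi> $ (r div 2^n) * cnj (\<psi> $ (s div 2^n)) else 0) else 0)"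
    using rs by (intro sum.cong refl) (auto simp: cadj_entry[of _ "2^(n+m)" "2^n"] ancilla_iso_def)
  also have "\<dots> = (if r mod 2^n = s mod 2^n then \<psi> $ (r div 2^n) * cnj (\<psi> $ (s div 2^n)) else 0)"
    by simp
  also have "\<dots> = ?R $$ (r,s)"
    using rs assms[of "r div 2^n" "s div 2^n"] div_less_exp[of r n m] div_less_exp[of s n m] by (simp add: ancilla_lift_def)
  finally show "(?V * cadj ?V) $$ (r,s) = ?R $$ (r,s)" .
qed (auto simp: ancilla_iso_def cadj_def)

section \<open>POVM elements as compressed rank-one projectors\<close>

definition ket_bra :: "nat \<Rightarrow> complex vec \<Rightarrow> complex mat" where
  "ket_bra N \<phi> = mat N N (\<lambda>(i,j). \<phi> $ i * cnj (\<phi> $ j))"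

lemma ket_bra_carrier [simp]: "ket_bra N \<phi> \<in> carrier_mat N N"
  by (simp add: ket_bra_def)

lemma conj_by_ket_bra:
  assumes "G \<in> carrier_mat N M" "\<phi> \<in> carrier_vec N"
  shows "conj_by G (ket_bra N \<phi>) = ket_bra M (cadj G *\<^sub>v \<phi>)"
proof (rule eq_matI)
  fix a b assume "a < dim_row (ket_bra M (cadj G *\<^sub>v \<phi>))" "b < dim_col (ket_bra M (cadj G *\<^sub>v \<phi>))"
  then have ab: "a < M" "b < M" by (auto simp: ket_bra_def)
  have w: "(cadj G *\<^sub>v \<phi>) $ x = (\<Sum>l<N. cadj G $$ (x,l) * \<phi> $ l)" if "x < M" for x
    using assms that by (intro mult_vec_entry) auto
  have c: "cadj G \<in> carrier_mat M N" using assms by simp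
  have 1: "(cadj G * ket_bra N \<phi>) $$ (a,l) = (cadj G *\<^sub>v \<phi>) $ a * cnj (\<phi> $ l)" if "l < N" for l
    using ab that by (subst mat_mult_entry[OF c ket_bra_carrier]) (auto simp: ket_bra_def w sum_distrib_right mult.assoc)
  have "conj_by G (ket_bra N \<phi>) $$ (a,b) = (\<Sum>l<N. (cadj G * ket_bra N \<phi>) $$ (a,l) * G $$ (l,b))"
    unfolding conj_by_def using assms ab by (intro mat_mult_entry[OF mult_carrier_mat[OF c ket_bra_carrier]])
  also have "\<dots> = (\<Sum>l<N. (cadj G *\<^sub>v \<phi>) $ a * cnj (cadj G $$ (b,l) * \<phi> $ l))"
    using assms ab by (intro sum.cong refl) (auto simp: 1 cadj_entry[of G N M])
  also have "\<dots> = (cadj G *\<^sub>v \<phi>) $ a * cnj ((cadj G *\<^sub>v \<phi>) $ b)"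
    unfolding w[OF ab(2)] by (simp add: sum_distrib_left)
  finally show "conj_by G (ket_bra N \<phi>) $$ (a,b) = ket_bra M (cadj G *\<^sub>v \<phi>) $$ (a,b)"
    using ab by (simp add: ket_bra_def)
qed (use assms in \<open>auto simp: conj_by_def cadj_def ket_bra_def\<close>)

lemma cadj_ancilla_iso_mult_vec:
  assumes "w \<in> carrier_vec (2^(n+m))" "a < 2^n"
  shows "(cadj (ancilla_iso n m \<psi>) *\<^sub>v w) $ a = (\<Sum>c<2^m. cnj (\<psi> $ c) * w $ (a + 2^n * c))"
proof -
  let ?V = "ancilla_iso n m \<psi>"
  have "(cadj ?V *\<^sub>v w) $ a = (\<Sum>r<2^(n+m). cadj ?V $$ (a,r) * w $ r)"
    using assms by (intro mult_vec_entry) auto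
  also have "\<dots> = (\<Sum>c<2^m. \<Sum>d<2^n. if a = d then cnj (\<psi> $ c) * w $ (a + 2^n * c) else 0)"
    unfolding sum_register_split using assms
    by (intro sum.cong refl) (auto simp: cadj_entry[of _ "2^(n+m)" "2^n"] ancilla_iso_def join_less_exp)
  also have "\<dots> = (\<Sum>c<2^m. cnj (\<psi> $ c) * w $ (a + 2^n * c))"
    using assms by simp
  finally show ?thesis .
qed

text \<open>Conjugating a rank-one projector conjugates its vector, which reproduces the coordinates
  in the definition. The right side is linear in the projector, so a Pauli expansion of it can be
  substituted.\<close>

lemma doped_povm_elem_eq:
  assumes "U \<in> carrier_mat (2^(n+m)) (2^(n+m))" "\<phi> \<in> carrier_vec (2^(n+m))"
  shows "doped_povm_elem n m \<psi> U \<phi> = conj_by (ancilla_iso n m \<psi>) (conj_by U (ket_bra (2^(n+m)) \<phi>))"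
proof -
  have w: "cadj U *\<^sub>v \<phi> \<in> carrier_vec (2^(n+m))" 
    using assms by (intro mult_mat_vec_carrier[of _ _ "2^(n+m)"]) auto
  show ?thesis
    unfolding conj_by_ket_bra[OF assms] conj_by_ket_bra[OF ancilla_iso_carrier w] doped_povm_elem_def Let_def ket_bra_def[of "2^n"]
    by (rule cong_mat) (auto simp: cadj_ancilla_iso_mult_vec[OF w])
qed

section \<open>Dimension count\<close>

text \<open>Lets commutation pass from generators to their span: from lifted stabilizers to
  \<open>V V^*\<close>, from \<open>L\<close> to the projectors, from the POVM elements to all
  matrices.\<close>

lemma commutant_msubspace:
  assumes "R \<in> carrier_mat n n"
  shows "msubspace n {A \<in> carrier_mat n n. R * A = A * R}"
  using assms unfolding msubspace_def
  by (auto simp: mult_add_distrib_mat[of _ n n _ n] add_mult_distrib_mat[of _ n n _ _ n]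
      mult_smult_distrib[of _ n n _ n] mult_smult_assoc_mat[of _ n n _ n]
      right_mult_zero_mat[of _ n n] left_mult_zero_mat[of _ n n])

text \<open>Comparing \<open>X * M\<close> with \<open>M * X\<close> for matrix units
  \<open>M\<close> kills the off-diagonal entries and equates the diagonal ones.\<close>

lemma scalar_if_commutes_with_all:
  assumes X: "X \<in> carrier_mat d d" and com: "\<And>M. M \<in> carrier_mat d d \<Longrightarrow> X * M = M * (X :: complex mat)"
  shows "\<exists>c. X = c \<cdot>\<^sub>m 1\<^sub>m d"
proof -
  have e: "X $$ (a,i) * (if j = b then 1 else 0) = (if a = i then 1 else 0) * X $$ (j,b)"
    if "a < d" "b < d" "i < d" "j < d" for a b i j
  proof -
    define M :: "complex mat" where "M = mat d d (\<lambda>(x,y). if x = i \<and> y = j then 1 else 0)"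
    have M: "M \<in> carrier_mat d d" by (simp add: M_def)
    have "(X * M) $$ (a,b) = (\<Sum>l<d. X $$ (a,l) * M $$ (l,b))"
      by (rule mat_mult_entry[OF X M that(1,2)])
    also have "\<dots> = (\<Sum>l\<in>{i}. X $$ (a,l) * (if j = b then 1 else 0))"
      by (rule sum.mono_neutral_cong_right) (use that in \<open>auto simp: M_def\<close>)
    finally have 1: "(X * M) $$ (a,b) = X $$ (a,i) * (if j = b then 1 else 0)" by simp
    have "(M * X) $$ (a,b) = (\<Sum>l<d. M $$ (a,l) * X $$ (l,b))"
      by (rule mat_mult_entry[OF M X that(1,2)])
    also have "\<dots> = (\<Sum>l\<in>{j}. (if a = i then 1 else 0) * X $$ (l,b))"
      by (rule sum.mono_neutral_cong_right) (use that in \<open>auto simp: M_def\<close>)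
    finally show ?thesis using 1 com[OF M] by simp
  qed
  have "X = X $$ (0,0) \<cdot>\<^sub>m 1\<^sub>m d"
  proof (rule eq_matI)
    fix a b assume "a < dim_row (X $$ (0,0) \<cdot>\<^sub>m 1\<^sub>m d)" "b < dim_col (X $$ (0,0) \<cdot>\<^sub>m 1\<^sub>m d)"
    then have ab: "a < d" "b < d" by auto
    show "X $$ (a,b) = (X $$ (0,0) \<cdot>\<^sub>m 1\<^sub>m d) $$ (a,b)"
    proof (cases "a = b")
      case True
      then show ?thesis using ab e[of a 0 a 0] by simp
    next
      case False
      then show ?thesis using ab e[of a b b b] by simp
    qed
  qed (use X in auto)
  then show ?thesis ..
qed

text \<open>If \<open>card W < d * d\<close>, the family and the coefficients of the matrix units,
  padded with zeros to square matrices \<open>X\<close> and \<open>Y\<close>, satisfy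
  \<open>X * Y = 1\<close>. Then \<open>Y * X = 1\<close> as well, although \<open>Y\<close> has a
  zero row.\<close>

lemma dimension_bound:
  fixes B :: "'i \<Rightarrow> complex mat"
  assumes fin: "finite W"
    and span: "\<And>M. M \<in> carrier_mat d d \<Longrightarrow> \<exists>f. M = mat d d (\<lambda>p. \<Sum>w\<in>W. f w * B w $$ p)"
  shows "d * d \<le> card W"
proof (rule ccontr)
  assume "\<not> d * d \<le> card W"
  then have K: "card W < d * d" by simp
  then have d: "d > 0" by (cases d) auto
  let ?K = "card W" and ?D = "d * d"
  obtain h where h: "bij_betw h {0..<?K} W" using ex_bij_betw_nat_finite[OF fin] by blast
  \<comment> \<open>The matrix units, numbered row by row: \<open>p\<close> stands for the position
    \<open>(p div d, p mod d)\<close>.\<close>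
  define E :: "nat \<Rightarrow> complex mat" where
    "E p = mat d d (\<lambda>(i,j). if i = p div d \<and> j = p mod d then 1 else 0)" for p
  have "\<forall>p. \<exists>f. E p = mat d d (\<lambda>q. \<Sum>w\<in>W. f w * B w $$ q)"
    using span by (simp add: E_def)
  then obtain f where f: "\<And>p. E p = mat d d (\<lambda>q. \<Sum>w\<in>W. f p w * B w $$ q)" by metis
  define X where "X = mat ?D ?D (\<lambda>(p,q). if q < ?K then B (h q) $$ (p div d, p mod d) else 0)"
  define Y where "Y = mat ?D ?D (\<lambda>(q,p). if q < ?K then f p (h q) else 0)"
  have XY: "X \<in> carrier_mat ?D ?D" "Y \<in> carrier_mat ?D ?D" by (simp_all add: X_def Y_def)
  have "X * Y = 1\<^sub>m ?D"
  proof (rule eq_matI)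
    fix p p' assume "p < dim_row (1\<^sub>m ?D :: complex mat)" "p' < dim_col (1\<^sub>m ?D :: complex mat)"
    then have p: "p < ?D" "p' < ?D" by auto
    have pd: "p div d < d" "p mod d < d" using p d by (auto simp: less_mult_imp_div_less)
    have "(X * Y) $$ (p,p') = (\<Sum>q<?D. X $$ (p,q) * Y $$ (q,p'))"
      by (rule mat_mult_entry[OF XY p])
    also have "\<dots> = (\<Sum>q\<in>{0..<?K}. f p' (h q) * B (h q) $$ (p div d, p mod d))"
      by (rule sum.mono_neutral_cong_right) (use p K in \<open>auto simp: X_def Y_def\<close>)
    also have "\<dots> = (\<Sum>w\<in>W. f p' w * B w $$ (p div d, p mod d))"
      by (rule sum.reindex_bij_betw[OF h])
    also have "\<dots> = E p' $$ (p div d, p mod d)" using pd by (subst f) simp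
    also have "\<dots> = (if p = p' then 1 else 0)"
    proof -
      have "p div d = p' div d \<and> p mod d = p' mod d \<longleftrightarrow> p = p'"
        by (metis div_mult_mod_eq)
      then show ?thesis using pd by (simp add: E_def)
    qed
    finally show "(X * Y) $$ (p,p') = 1\<^sub>m ?D $$ (p,p')" using p by simp
  qed (use XY in auto)
  then have "Y * X = 1\<^sub>m ?D" by (rule mat_mult_left_right_inverse[OF XY])
  \<comment> \<open>Row \<open>?K\<close> is the first padded row of \<open>Y\<close>; it exists
    because \<open>?K < d * d\<close>.\<close>
  moreover have "(Y * X) $$ (?K,?K) = (\<Sum>q<?D. Y $$ (?K,q) * X $$ (q,?K))"
    by (rule mat_mult_entry[OF XY(2,1) K K])
  moreover have "(\<Sum>q<?D. Y $$ (?K,q) * X $$ (q,?K)) = 0"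
    by (rule sum.neutral) (use K in \<open>auto simp: Y_def\<close>)
  ultimately show False using K by simp
qed

lemma combinations_msubspace:
  assumes "finite W"
  shows "msubspace d {M. \<exists>f. M = mat d d (\<lambda>p. \<Sum>w\<in>W. f w * (B w :: complex mat) $$ p)}" (is "msubspace d ?T")
  unfolding msubspace_def
proof (intro conjI ballI allI)
  show "?T \<subseteq> carrier_mat d d" by auto
  have "0\<^sub>m d d = mat d d (\<lambda>p. \<Sum>w\<in>W. 0 * B w $$ p)" by (rule eq_matI) auto
  then show "0\<^sub>m d d \<in> ?T" by (intro CollectI exI[of _ "\<lambda>_. 0"])
next
  fix X Y assume "X \<in> ?T" "Y \<in> ?T"
  then obtain f g where "X = mat d d (\<lambda>p. \<Sum>w\<in>W. f w * B w $$ p)" "Y = mat d d (\<lambda>p. \<Sum>w\<in>W. g w * B w $$ p)"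
    by blast
  then have "X + Y = mat d d (\<lambda>p. \<Sum>w\<in>W. (f w + g w) * B w $$ p)"
    by (intro eq_matI) (auto simp: distrib_right sum.distrib)
  then show "X + Y \<in> ?T" by (intro CollectI exI[of _ "\<lambda>w. f w + g w"])
next
  fix X c assume "X \<in> ?T"
  then obtain f where "X = mat d d (\<lambda>p. \<Sum>w\<in>W. f w * B w $$ p)" by blast
  then have "c \<cdot>\<^sub>m X = mat d d (\<lambda>p. \<Sum>w\<in>W. (c * f w) * B w $$ p)"
    by (intro eq_matI) (auto simp: sum_distrib_left mult.assoc)
  then show "c \<cdot>\<^sub>m X \<in> ?T" by (intro CollectI exI[of _ "\<lambda>w. c * f w"])
qed

lemma smult_in_combinations:
  assumes "finite W" "w \<in> W" "B w \<in> carrier_mat d d"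
  shows "\<exists>f. c \<cdot>\<^sub>m B w = mat d d (\<lambda>p. \<Sum>v\<in>W. f v * (B v :: complex mat) $$ p)"
proof (rule exI, rule eq_matI)
  fix i j assume "i < dim_row (mat d d (\<lambda>p. \<Sum>v\<in>W. (if v = w then c else 0) * B v $$ p))"
    "j < dim_col (mat d d (\<lambda>p. \<Sum>v\<in>W. (if v = w then c else 0) * B v $$ p))"
  then have ij: "i < d" "j < d" by auto
  have "(\<Sum>v\<in>W. (if v = w then c else 0) * B v $$ (i,j)) = (\<Sum>v\<in>W. if v = w then c * B w $$ (i,j) else 0)"
    by (rule sum.cong) auto
  then show "(c \<cdot>\<^sub>m B w) $$ (i,j) = mat d d (\<lambda>p. \<Sum>v\<in>W. (if v = w then c else 0) * B v $$ p) $$ (i,j)"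
    using assms ij by simp
qed (use assms in auto)

text \<open>If \<open>R\<close> anticommutes with a lifted stabilizer \<open>Q\<close>, then
  \<open>Q V = V\<close> and \<open>V^* Q = V^*\<close> give
  \<open>V^* R V = V^* R Q V = - V^* Q R V = - V^* R V\<close>, so the compression vanishes.
  Otherwise \<open>R\<close> commutes with all lifted stabilizers and hence with their average
  \<open>V V^*\<close>.\<close>

lemma ancilla_compress_pauli:
  assumes st: "stabilizer_state m \<psi>" and R: "R \<in> paulis (n+m)"
  defines "V \<equiv> ancilla_iso n m \<psi>"
  shows "conj_by V R = 0\<^sub>m (2^n) (2^n) \<or> R * (V * cadj V) = (V * cadj V) * R"
proof -
  let ?N = "2^(n+m) :: nat" and ?d = "2^n :: nat"
  from st obtain S where S: "S \<subseteq> paulis m" "1\<^sub>m (2^m) \<in> S" "\<forall>A\<in>S. \<forall>B\<in>S. A * B \<in> S \<and> A * B = B * A"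
    "card S = 2^m" "- 1\<^sub>m (2^m) \<notin> S" "\<forall>P\<in>S. P *\<^sub>v \<psi> = \<psi>"
    unfolding stabilizer_state_def by (elim conjE exE) (rule that)
  from st have \<psi>: "\<psi> \<in> carrier_vec (2^m)" "(\<Sum>i<2^m. cmod (\<psi> $ i)^2) = 1"
    unfolding stabilizer_state_def by blast+
  have S3: "\<forall>A\<in>S. \<forall>B\<in>S. A * B \<in> S" using S(3) by blast
  have fin: "finite S" using S(4) by (metis card.infinite power_not_zero zero_neq_numeral)
  note Rc = paulis_carrier[OF R]
  have V: "V \<in> carrier_mat ?N ?d" unfolding V_def by simp
  have cV: "cadj V \<in> carrier_mat ?d ?N" using V by simp
  have Pc: "P \<in> carrier_mat (2^m) (2^m)" if "P \<in> S" for P using S(1) that paulis_carrier by blast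
  show ?thesis
  proof (cases "\<forall>P\<in>S. R * ancilla_lift n m P = ancilla_lift n m P * R")
    case True
    have "V * cadj V = mat ?N ?N (\<lambda>p. \<Sum>P\<in>S. 1 / 2^m * ancilla_lift n m P $$ p)"
      unfolding V_def
      by (rule ancilla_iso_range_projector) (rule stabilizer_projector[OF S(1,2) S3 S(4,5) \<psi> S(6)])
    also have "\<dots> \<in> {A \<in> carrier_mat ?N ?N. R * A = A * R}"
      by (rule msubspace_sum[OF commutant_msubspace[OF Rc] fin]) (use True in auto)
    finally show ?thesis by blast
  next
    case False
    then obtain P where P: "P \<in> S" "R * ancilla_lift n m P \<noteq> ancilla_lift n m P * R" by blast
    define Q where "Q = ancilla_lift n m P"
    have Q: "Q \<in> carrier_mat ?N ?N" by (simp add: Q_def)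
    have Pp: "P \<in> paulis m" using P S by blast
    have RQ: "R * Q = - (Q * R)"
      using paulis_commute_or_anticommute[OF R ancilla_lift_paulis[OF Pp]] P(2) unfolding Q_def by blast
    have "cadj P = P"
      using pauli_involution_hermitian[OF Pp involution_in_stabilizer[OF S(1) S3 S(5) P(1)]] .
    then have Qh: "cadj Q = Q" unfolding Q_def by (simp add: ancilla_lift_cadj[OF Pc[OF P(1)]])
    have QV: "Q * V = V"
      unfolding Q_def V_def using ancilla_lift_mult_iso[OF Pc[OF P(1)] \<psi>(1)] S(6) P(1) by blast
    then have VQ: "cadj V * Q = cadj V" using cadj_mult[OF Q V] Qh by simp
    have RV: "R * V \<in> carrier_mat ?N ?d" "Q * R \<in> carrier_mat ?N ?N" using Rc V Q by auto
    have e: "conj_by V R = cadj V * (R * V)"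
      unfolding conj_by_def by (rule assoc_mult_mat[OF cV Rc V])
    have "R * V = R * (Q * V)" by (simp only: QV)
    also have "\<dots> = (R * Q) * V" by (rule assoc_mult_mat[OF Rc Q V, symmetric])
    also have "\<dots> = - ((Q * R) * V)" unfolding RQ by (rule uminus_mult_left_mat) (use RV V in auto)
    also have "(Q * R) * V = Q * (R * V)" by (rule assoc_mult_mat[OF Q Rc V])
    finally have "cadj V * (R * V) = cadj V * (- (Q * (R * V)))" by (rule arg_cong)
    also have "\<dots> = - (cadj V * (Q * (R * V)))"
      by (rule uminus_mult_right_mat) (use cV Q RV in auto)
    also have "cadj V * (Q * (R * V)) = (cadj V * Q) * (R * V)"
      by (rule assoc_mult_mat[OF cV Q RV(1), symmetric])
    finally have neg: "conj_by V R = - conj_by V R" unfolding VQ e .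
    have "conj_by V R = 0\<^sub>m ?d ?d"
    proof (rule eq_matI)
      fix i j assume "i < dim_row (0\<^sub>m ?d ?d :: complex mat)" "j < dim_col (0\<^sub>m ?d ?d :: complex mat)"
      then have ij: "i < ?d" "j < ?d" by auto
      have c: "conj_by V R \<in> carrier_mat ?d ?d" by (rule conj_by_carrier[OF V Rc])
      have "conj_by V R $$ (i,j) = (- conj_by V R) $$ (i,j)" using neg by simp
      also have "\<dots> = - (conj_by V R $$ (i,j))" using c ij by (intro index_uminus_mat) auto
      finally show "conj_by V R $$ (i,j) = 0\<^sub>m ?d ?d $$ (i,j)" using ij by simp
    qed (use conj_by_carrier[OF V Rc] in auto)
    then show ?thesis ..
  qed
qed

text \<open>Compression is not multiplicative in general, as \<open>V V^*\<close> stands between the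
  factors. If one factor commutes with it, it can be moved to the outer \<open>V^*\<close> or
  \<open>V\<close>, where \<open>V^* V = 1\<close> absorbs it.\<close>

lemma isometry_compress_mult:
  assumes V: "V \<in> carrier_mat N d" "cadj V * V = 1\<^sub>m d"
    and AB: "A \<in> carrier_mat N N" "B \<in> carrier_mat N N"
    and com: "A * (V * cadj V) = (V * cadj V) * A \<or> B * (V * cadj V) = (V * cadj V) * B"
  shows "conj_by V A * conj_by V B = conj_by V (A * B)"
proof -
  define W where "W = cadj V"
  have W: "W \<in> carrier_mat d N" "W * V = 1\<^sub>m d" using V by (simp_all add: W_def)
  have c: "W * A \<in> carrier_mat d N" "A * V \<in> carrier_mat N d" "W * B \<in> carrier_mat d N" "B * V \<in> carrier_mat N d"
    "A * B \<in> carrier_mat N N" "V * W \<in> carrier_mat N N"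
    using V(1) AB W(1) by (auto intro: mult_carrier_mat)
  note WBV = mult_carrier_mat[OF c(3) V(1)] and ABV = mult_carrier_mat[OF AB(1) c(4)]
    and VWBV = mult_carrier_mat[OF c(6) c(4)]
  note WABV = mult_carrier_mat[OF W(1) ABV]
  have expand: "conj_by V A * conj_by V B = W * (A * ((V * W) * (B * V)))"
  proof -
    have "conj_by V A * conj_by V B = (W * A * V) * (W * B * V)" by (simp only: conj_by_def W_def)
    also have "\<dots> = (W * A) * (V * (W * B * V))"
      by (rule assoc_mult_mat[OF c(1) V(1) WBV])
    also have "W * B * V = W * (B * V)" by (rule assoc_mult_mat[OF W(1) AB(2) V(1)])
    also have "V * (W * (B * V)) = (V * W) * (B * V)" by (rule assoc_mult_mat[OF V(1) W(1) c(4), symmetric])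
    also have "(W * A) * ((V * W) * (B * V)) = W * (A * ((V * W) * (B * V)))"
      by (rule assoc_mult_mat[OF W(1) AB(1) VWBV])
    finally show ?thesis .
  qed
  have goal: "conj_by V (A * B) = W * (A * (B * V))"
  proof -
    have "conj_by V (A * B) = W * (A * B * V)"
      unfolding conj_by_def W_def[symmetric] by (rule assoc_mult_mat[OF W(1) c(5) V(1)])
    then show ?thesis by (simp only: assoc_mult_mat[OF AB V(1)])
  qed
  from com show ?thesis
  proof
    assume "A * (V * cadj V) = (V * cadj V) * A"
    then have com: "A * (V * W) = (V * W) * A" by (simp only: W_def)
    have "W * (A * ((V * W) * (B * V))) = W * ((A * (V * W)) * (B * V))"
      by (simp only: assoc_mult_mat[OF AB(1) c(6,4)])
    also have "\<dots> = W * ((V * W) * (A * (B * V)))"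
      unfolding com by (simp only: assoc_mult_mat[OF c(6) AB(1) c(4)])
    also have "\<dots> = W * (V * (W * (A * (B * V))))"
      by (simp only: assoc_mult_mat[OF V(1) W(1) ABV])
    also have "\<dots> = (W * V) * (W * (A * (B * V)))"
      by (rule assoc_mult_mat[OF W(1) V(1) WABV, symmetric])
    also have "\<dots> = W * (A * (B * V))"
      unfolding W(2) by (rule left_mult_one_mat[OF WABV])
    finally show ?thesis unfolding expand goal .
  next
    assume "B * (V * cadj V) = (V * cadj V) * B"
    then have com: "B * (V * W) = (V * W) * B" by (simp only: W_def)
    have "(V * W) * (B * V) = (V * W) * B * V"
      by (rule assoc_mult_mat[OF c(6) AB(2) V(1), symmetric])
    also have "\<dots> = B * ((V * W) * V)"
      unfolding com[symmetric] by (rule assoc_mult_mat[OF AB(2) c(6) V(1)])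
    also have "(V * W) * V = V * (W * V)" by (rule assoc_mult_mat[OF V(1) W(1) V(1)])
    also have "\<dots> = V" unfolding W(2) by (rule right_mult_one_mat[OF V(1)])
    finally show ?thesis by (simp only: expand goal)
  qed
qed

lemma commute_mult_mat:
  fixes A B C :: "complex mat"
  assumes "A \<in> carrier_mat n n" "B \<in> carrier_mat n n" "C \<in> carrier_mat n n"
    "A * C = C * A" "B * C = C * B"
  shows "(A * B) * C = C * (A * B)"
proof -
  have "(A * B) * C = A * (B * C)" using assms by (intro assoc_mult_square_mat[of _ n])
  also have "\<dots> = (A * C) * B" unfolding assms(5) using assms by (intro assoc_mult_square_mat[of _ n, symmetric])
  also have "\<dots> = C * (A * B)" unfolding assms(4) using assms by (intro assoc_mult_square_mat[of _ n])
  finally show ?thesis .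
qed

lemma three_power_bound:
  assumes "2^n * 2^n \<le> (3::nat)^t"
  shows "real t \<ge> 2 / log 2 3 * real n"
proof -
  have "real (2^n * 2^n) \<le> real (3^t)" using assms by (simp only: of_nat_le_iff)
  then have "(2::real) ^ (2 * n) \<le> 3 ^ t" by (simp add: power_add mult_2)
  then have "log 2 (2 ^ (2 * n)) \<le> log 2 (3 ^ t)" by (subst log_le_cancel_iff) auto
  then have "2 * real n \<le> real t * log 2 3" by (simp add: log_nat_power)
  moreover have "log 2 3 > (0::real)" by simp
  ultimately show ?thesis by (simp add: field_simps)
qed

theorem theorem4:
  fixes n m t :: nat and \<psi> :: "complex vec" and C :: "gate list" and \<Phi> :: "nat \<Rightarrow> complex vec"
  assumes "stabilizer_state m \<psi>"
    and "\<forall>g\<in>set C. gate_wf (n + m) g"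
    and "T_count C = t"
    and "stabilizer_basis (n + m) \<Phi>"
    and "informationally_complete n
           (\<lambda>b. doped_povm_elem n m \<psi> (circuit_mat (n + m) C) (\<Phi> b)) (2^(n + m))"
  shows "real t \<ge> 2 / log 2 3 * real n"
proof -
  define k where "k = n + m"
  define N where "N = (2::nat)^k"
  define d where "d = (2::nat)^n"
  define U where "U = circuit_mat k C"
  define V where "V = ancilla_iso n m \<psi>"
  have wf: "\<forall>g\<in>set C. gate_wf k g" using assms(2) by (simp add: k_def)
  have U: "U \<in> carrier_mat N N" by (simp add: U_def N_def)
  have UU: "U * cadj U = 1\<^sub>m N" unfolding U_def N_def by (rule circuit_unitary'[OF wf])
  have V: "V \<in> carrier_mat N d" by (simp add: V_def N_def k_def d_def)
  have VV: "cadj V * V = 1\<^sub>m d"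
    using assms(1) unfolding stabilizer_state_def V_def d_def by (intro ancilla_iso_isometry) blast
  have P_carrier: "P \<in> carrier_mat N N" if "P \<in> paulis k" for P using paulis_carrier[OF that] by (simp add: N_def)
  obtain L where L: "L \<subseteq> paulis k" "\<forall>P\<in>L. \<forall>Q\<in>L. P * Q = Q * P"
    "\<forall>b<2^k. \<exists>S\<subseteq>L. finite S \<and>
       (\<forall>a<2^k. \<forall>a'<2^k. \<Phi> b $ a * cnj (\<Phi> b $ a') = (\<Sum>P\<in>S. 1 / 2^k * P $$ (a,a')))"
    using stabilizer_basis_expand[OF assms(4)] unfolding k_def[symmetric] by (elim exE conjE) (rule that)
  have \<Phi>: "\<Phi> b \<in> carrier_vec N" if "b < N" for b
    using conjunct1[OF assms(4)[unfolded stabilizer_basis_def]] that by (simp add: N_def k_def)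
  \<comment> \<open>The Pauli expansion in test form, applied below to a commutant and to a preimage
    of \<open>T\<close>.\<close>
  have span: "ket_bra N (\<Phi> b) \<in> W" if W: "msubspace N W" "L \<subseteq> W" and b: "b < N" for W b
  proof -
    obtain S where S: "S \<subseteq> L" "finite S"
      "\<forall>a<2^k. \<forall>a'<2^k. \<Phi> b $ a * cnj (\<Phi> b $ a') = (\<Sum>P\<in>S. 1 / 2^k * P $$ (a,a'))"
      using L(3) b unfolding N_def by blast
    have "ket_bra N (\<Phi> b) = mat N N (\<lambda>p. \<Sum>P\<in>S. 1 / 2^k * P $$ p)"
      using S(3) by (intro eq_matI) (auto simp: ket_bra_def N_def)
    also have "\<dots> \<in> W" using S W by (intro msubspace_sum) auto
    finally show ?thesis .
  qed
  define \<mu> where "\<mu> b = conj_by V (conj_by U (ket_bra N (\<Phi> b)))" for b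
  have \<mu>_eq: "doped_povm_elem n m \<psi> (circuit_mat (n + m) C) (\<Phi> b) = \<mu> b" if "b < N" for b
    unfolding \<mu>_def V_def U_def N_def k_def
    by (rule doped_povm_elem_eq) (use U \<Phi>[OF that] in \<open>auto simp: U_def N_def k_def\<close>)
  \<comment> \<open>Informational completeness in test form: a subspace that contains all elements
    is everything.\<close>
  have complete: "M \<in> W" if M: "M \<in> carrier_mat d d" and W: "msubspace d W" "\<And>b. b < N \<Longrightarrow> \<mu> b \<in> W" for M W
  proof -
    obtain c where "M = mat d d (\<lambda>(i,j). \<Sum>b<N. c b *
        doped_povm_elem n m \<psi> (circuit_mat (n + m) C) (\<Phi> b) $$ (i,j))"
      using assms(5) M unfolding informationally_complete_def d_def N_def k_def by blast
    then have "M = mat d d (\<lambda>p. \<Sum>b<N. c b * \<mu> b $$ p)"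
      by (auto simp: \<mu>_eq intro!: eq_matI)
    also have "\<dots> \<in> W" using W by (intro msubspace_sum) auto
    finally show ?thesis .
  qed
  have F: "ket_bra N (\<Phi> b) \<in> carrier_mat N N" for b by simp
  have UF: "conj_by U (ket_bra N (\<Phi> b)) \<in> carrier_mat N N" for b
    by (rule conj_by_carrier[OF U F])
  have branch_paulis: "R \<in> paulis k" if "pauli_branch k P C w R" "P \<in> L" for P w R
    using pauli_branch_paulis[OF that(1) _ wf] that(2) L(1) by blast
  \<comment> \<open>\<open>P\<close> and \<open>P'\<close> may differ and come from different
    projectors; this collapse makes the final bound independent of \<open>m\<close>.\<close>
  have key: "\<exists>c. conj_by V R' = c \<cdot>\<^sub>m conj_by V R"
    if b: "pauli_branch k P C w R" "pauli_branch k P' C w R'" "P \<in> L" "P' \<in> L"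
      and nz: "conj_by V R \<noteq> 0\<^sub>m d d" for P P' w R R'
  proof (cases "conj_by V R' = 0\<^sub>m d d")
    case True
    then have "conj_by V R' = 0 \<cdot>\<^sub>m conj_by V R"
      using conj_by_carrier[OF V P_carrier[OF branch_paulis[OF b(1,3)]]] by (auto intro!: eq_matI)
    then show ?thesis ..
  next
    case nz': False
    have Rp: "R \<in> paulis k" "R' \<in> paulis k" using branch_paulis b by blast+
    have Pp: "P \<in> paulis k" "P' \<in> paulis k" using b L by blast+
    note Rc = P_carrier[OF Rp(1)] P_carrier[OF Rp(2)] P_carrier[OF paulis_mult[OF Rp]]
    note Pc = P_carrier[OF Pp(1)] P_carrier[OF Pp(2)] P_carrier[OF paulis_mult[OF Pp]]
    let ?W = "V * cadj V"
    have Wc: "?W \<in> carrier_mat N N" using V by auto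
    have RW: "R * ?W = ?W * R" "R' * ?W = ?W * R'"
      using ancilla_compress_pauli[OF assms(1), of _ n] Rp nz nz'
      unfolding V_def d_def k_def by blast+
    have RRW: "(R * R') * ?W = ?W * (R * R')" by (rule commute_mult_mat[OF Rc(1,2) Wc RW])
    \<comment> \<open>\<open>P P'\<close> commutes with every projector because \<open>L\<close> is
      commutative. Conjugation by \<open>U\<close> carries this over to \<open>R R'\<close>, and the
      unknown sign cancels.\<close>
    have RRF: "(R * R') * conj_by U (ket_bra N (\<Phi> b)) = conj_by U (ket_bra N (\<Phi> b)) * (R * R')"
      if bN: "b < N" for b
    proof -
      have "ket_bra N (\<Phi> b) \<in> {A \<in> carrier_mat N N. (P * P') * A = A * (P * P')}"
      proof (rule span[OF commutant_msubspace[OF Pc(3)] _ bN], rule subsetI)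
        fix Q assume Q: "Q \<in> L"
        then have "Q \<in> carrier_mat N N" using L(1) P_carrier by blast
        moreover have "P * Q = Q * P" "P' * Q = Q * P'" using L(2) b Q by blast+
        ultimately show "Q \<in> {A \<in> carrier_mat N N. (P * P') * A = A * (P * P')}"
          using commute_mult_mat[OF Pc(1,2)] by blast
      qed
      then have "conj_by U ((P * P') * ket_bra N (\<Phi> b)) = conj_by U (ket_bra N (\<Phi> b) * (P * P'))"
        by simp
      then have c: "conj_by U (P * P') * conj_by U (ket_bra N (\<Phi> b)) =
          conj_by U (ket_bra N (\<Phi> b)) * conj_by U (P * P')"
        unfolding conj_by_mult[OF U Pc(3) F UU] conj_by_mult[OF U F Pc(3) UU] .
      have "conj_by U (P * P') = R * R' \<or> conj_by U (P * P') = - (R * R')"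
        unfolding U_def by (rule conj_circuit_branch_product[OF b(1,2) Pp wf])
      then show ?thesis
      proof
        assume "conj_by U (P * P') = - (R * R')"
        then have "- (R * R') * conj_by U (ket_bra N (\<Phi> b)) = conj_by U (ket_bra N (\<Phi> b)) * - (R * R')"
          using c by (simp only:)
        moreover have "- (R * R') * conj_by U (ket_bra N (\<Phi> b)) = - ((R * R') * conj_by U (ket_bra N (\<Phi> b)))"
          by (rule uminus_mult_left_mat) (use Rc UF[of b] in auto)
        moreover have "conj_by U (ket_bra N (\<Phi> b)) * - (R * R') = - (conj_by U (ket_bra N (\<Phi> b)) * (R * R'))"
          by (rule uminus_mult_right_mat) (use Rc UF[of b] in auto)
        ultimately have "- ((R * R') * conj_by U (ket_bra N (\<Phi> b))) = - (conj_by U (ket_bra N (\<Phi> b)) * (R * R'))"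
          by (simp only:)
        then have "- (- ((R * R') * conj_by U (ket_bra N (\<Phi> b)))) = - (- (conj_by U (ket_bra N (\<Phi> b)) * (R * R')))"
          by (rule arg_cong)
        then show ?thesis by (simp only: uminus_uminus_mat)
      qed (use c in simp)
    qed
    have X: "conj_by V R * conj_by V R' = conj_by V (R * R')"
      by (rule isometry_compress_mult[OF V VV Rc(1,2)]) (use RW in blast)
    have Xc: "conj_by V (R * R') \<in> carrier_mat d d" by (rule conj_by_carrier[OF V Rc(3)])
    have "\<exists>c. conj_by V (R * R') = c \<cdot>\<^sub>m 1\<^sub>m d"
    proof (rule scalar_if_commutes_with_all[OF Xc])
      fix M :: "complex mat" assume M: "M \<in> carrier_mat d d"
      have "M \<in> {A \<in> carrier_mat d d. conj_by V (R * R') * A = A * conj_by V (R * R')}"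
      proof (rule complete[OF M commutant_msubspace[OF Xc]])
        fix b assume bN: "b < N"
        have "conj_by V (R * R') * \<mu> b = conj_by V ((R * R') * conj_by U (ket_bra N (\<Phi> b)))"
          unfolding \<mu>_def by (rule isometry_compress_mult[OF V VV Rc(3) UF]) (use RRW in blast)
        also have "\<dots> = \<mu> b * conj_by V (R * R')"
          unfolding RRF[OF bN] \<mu>_def
          by (rule isometry_compress_mult[OF V VV UF Rc(3), symmetric]) (use RRW in blast)
        finally show "\<mu> b \<in> {A \<in> carrier_mat d d. conj_by V (R * R') * A = A * conj_by V (R * R')}"
          using conj_by_carrier[OF V UF[of b]] by (simp add: \<mu>_def)
      qed
      then show "conj_by V (R * R') * M = M * conj_by V (R * R')" by blast
    qed
    then obtain c where c: "conj_by V R * conj_by V R' = c \<cdot>\<^sub>m 1\<^sub>m d" using X by metis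
    define A where "A = conj_by V R"
    define B where "B = conj_by V R'"
    have AB: "A \<in> carrier_mat d d" "B \<in> carrier_mat d d"
      unfolding A_def B_def using conj_by_carrier[OF V] Rc by blast+
    \<comment> \<open>\<open>R * R\<close> is a sign, so \<open>A * A\<close> is one too, and
      multiplying \<open>A * B = c\<close> by \<open>A\<close> expresses \<open>B\<close> as a
      multiple of \<open>A\<close>.\<close>
    have "A * A = conj_by V (R * R)"
      unfolding A_def by (rule isometry_compress_mult[OF V VV Rc(1,1)]) (use RW in blast)
    moreover have "conj_by V (1\<^sub>m N) = 1\<^sub>m d"
      unfolding conj_by_def using V VV by (simp add: right_mult_one_mat[of _ d N])
    moreover have "R * R = 1\<^sub>m N \<or> R * R = - 1\<^sub>m N" using paulis_square[OF Rp(1)] by (simp add: N_def)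
    ultimately have AA: "A * A = 1\<^sub>m d \<or> A * A = - 1\<^sub>m d"
      using conj_by_uminus[OF V, of "1\<^sub>m N"] by auto
    have "A * (A * B) = c \<cdot>\<^sub>m A"
      using c AB unfolding A_def[symmetric] B_def[symmetric] by (simp add: mult_smult_distrib[of _ d d _ d])
    then have AAB: "A * A * B = c \<cdot>\<^sub>m A" using assoc_mult_square_mat[OF AB(1,1,2)] by simp
    from AA have "B = c \<cdot>\<^sub>m A \<or> B = (-c) \<cdot>\<^sub>m A"
    proof
      assume "A * A = 1\<^sub>m d"
      then show ?thesis using AAB AB by simp
    next
      assume "A * A = - 1\<^sub>m d"
      then have "- 1\<^sub>m d * B = c \<cdot>\<^sub>m A" using AAB by simp
      moreover have "- 1\<^sub>m d * B = - (1\<^sub>m d * B)" by (rule uminus_mult_left_mat) (use AB in auto)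
      ultimately have "- B = c \<cdot>\<^sub>m A" using AB by simp
      then have "- (- B) = - (c \<cdot>\<^sub>m A)" by simp
      also have "- (c \<cdot>\<^sub>m A) = (-c) \<cdot>\<^sub>m A" by (rule eq_matI) auto
      finally have "B = (-c) \<cdot>\<^sub>m A" by (simp only: uminus_uminus_mat)
      then show ?thesis ..
    qed
    then show ?thesis unfolding A_def B_def by blast
  qed
  define Ws where "Ws = {w::nat list. set w \<subseteq> {..<3} \<and> length w = t}"
  have Ws: "finite Ws" "card Ws = 3^t"
    unfolding Ws_def by (simp_all add: finite_lists_length_eq card_lists_length_eq)
  \<comment> \<open>One matrix per word: a nonzero compression if some branch with this word has
    one, and zero otherwise.\<close>
  have "\<forall>w. \<exists>B\<in>carrier_mat d d. \<forall>P\<in>L. \<forall>R. pauli_branch k P C w R \<longrightarrow> (\<exists>c. conj_by V R = c \<cdot>\<^sub>m B)"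
  proof
    fix w
    show "\<exists>B\<in>carrier_mat d d. \<forall>P\<in>L. \<forall>R. pauli_branch k P C w R \<longrightarrow> (\<exists>c. conj_by V R = c \<cdot>\<^sub>m B)"
    proof (cases "\<exists>P\<in>L. \<exists>R. pauli_branch k P C w R \<and> conj_by V R \<noteq> 0\<^sub>m d d")
      case True
      then obtain P R where PR: "P \<in> L" "pauli_branch k P C w R" "conj_by V R \<noteq> 0\<^sub>m d d" by blast
      show ?thesis
      proof (rule bexI[of _ "conj_by V R"])
        show "conj_by V R \<in> carrier_mat d d"
          by (rule conj_by_carrier[OF V P_carrier[OF branch_paulis[OF PR(2,1)]]])
      qed (use key PR in blast)
    next
      case False
      have "0\<^sub>m d d = (0::complex) \<cdot>\<^sub>m 0\<^sub>m d d" by (rule eq_matI) auto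
      then show ?thesis using False by (intro bexI[of _ "0\<^sub>m d d"]) auto
    qed
  qed
  then obtain B where B: "\<And>w. B w \<in> carrier_mat d d"
    "\<And>w P R. P \<in> L \<Longrightarrow> pauli_branch k P C w R \<Longrightarrow> \<exists>c. conj_by V R = c \<cdot>\<^sub>m B w"
    by metis
  define T where "T = {M. \<exists>f. M = mat d d (\<lambda>p. \<Sum>w\<in>Ws. f w * B w $$ p)}"
  have T: "msubspace d T" unfolding T_def by (rule combinations_msubspace[OF Ws(1)])
  \<comment> \<open>The target \<open>T\<close> is pulled back along \<open>V\<close>, where
    membership is tested on branches, and then along \<open>U\<close>, where it is tested on
    \<open>L\<close>.\<close>
  have T': "msubspace N {A \<in> carrier_mat N N. conj_by V A \<in> T}" (is "msubspace N ?T'")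
    by (rule conj_by_msubspace[OF V T])
  have \<mu>T: "\<mu> b \<in> T" if "b < N" for b
  proof -
    have "ket_bra N (\<Phi> b) \<in> {A \<in> carrier_mat N N. conj_by U A \<in> ?T'}"
    proof (rule span[OF conj_by_msubspace[OF U T'] _ that], rule subsetI)
      fix P assume P: "P \<in> L"
      have "conj_by U P \<in> ?T'"
        unfolding U_def
      proof (rule conj_circuit_in_msubspace[OF _ wf])
        show "P \<in> paulis k" using P L by blast
        show "msubspace (2^k) ?T'" using T' by (simp add: N_def)
        fix w R assume R: "pauli_branch k P C w R"
        have "w \<in> Ws" using pauli_branch_word[OF R] assms(3) by (simp add: Ws_def)
        moreover obtain c where "conj_by V R = c \<cdot>\<^sub>m B w" using B(2)[OF P R] by blast
        ultimately have "conj_by V R \<in> T"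
          unfolding T_def using smult_in_combinations[OF Ws(1) _ B(1)] by auto
        then show "R \<in> ?T'" using P_carrier[OF branch_paulis[OF R P]] by blast
      qed
      then show "P \<in> {A \<in> carrier_mat N N. conj_by U A \<in> ?T'}" using P L P_carrier by blast
    qed
    then show ?thesis unfolding \<mu>_def by blast
  qed
  have "d * d \<le> card Ws"
  proof (rule dimension_bound[OF Ws(1)])
    fix M :: "complex mat" assume "M \<in> carrier_mat d d"
    then have "M \<in> T" using complete T \<mu>T by blast
    then show "\<exists>f. M = mat d d (\<lambda>p. \<Sum>w\<in>Ws. f w * B w $$ p)" unfolding T_def by blast
  qed
  then show ?thesis unfolding Ws(2) d_def by (rule three_power_bound)
qed

end
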